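(* Let $A \in \mathbb{C}^{n\times n}$ be Schur stable, $B\in\mathbb{C}^{n\times m}$, $C\in\mathbb{C}^{l\times n}$, $D\in\mathbb{C}^{l\times m}$. Let $\mu_{\mathrm{opt}}$ be the optimal value of the semidefinite program $$\mu_{\mathrm{opt}} = \max_{V}\ \operatorname{Tr}\left(\begin{bmatrix} C & D\end{bmatrix} V \begin{bmatrix} C & D\end{bmatrix}^*\right)$$ over Hermitian $V\in\mathbb{C}^{(n+m)\times(n+m)}$ subject to $$\begin{bmatrix} I_n & 0_{n,m}\end{bmatrix} V \begin{bmatrix} I_n \\ 0_{m,n}\end{bmatrix} = \begin{bmatrix} A & B\end{bmatrix} V \begin{bmatrix} A^* \\ B^*\end{bmatrix},\qquad \operatorname{Tr}\left(\begin{bmatrix} 0_{m,n} & I_m\end{bmatrix} V \begin{bmatrix} 0_{m,n} & I_m\end{bmatrix}^*\right)\le 1,\qquad V\succeq 0.$$ Let $\|\mathcal{M}\|_\infty^2$ be the optimal value of the infinite-dimensional problem $$\|\mathcal{M}\|_\infty^2 = \max_{\mathbf{w},\mathbf{x}}\ \lim_{N\to\infty}\frac1N\sum_{k=0}^{N-1} z_k^* z_k$$ over sequences $\mathbf{w}=(w_k)_{k\ge 0}$ in $\mathbb{C}^m$ and $\mathbf{x}=(x_k)_{k\ge0}$ in $\mathbb{C}^n$ subject to $x_0=0$, $x_{k+1}=Ax_k+Bw_k$ and $z_k=Cx_k+Dw_k$ for all $k\ge 0$, and $\|\mathbf{w}\|_p\le 1$. Then $$\mu_{\mathrm{opt}}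 = \|\mathcal{M}\|_\infty^2 .$$
   Context: $W^*$ is the conjugate transpose of $W$; $X\succeq 0$ means $X$ is (Hermitian) positive semidefinite; $I_n$ is the $n\times n$ identity and $0_{m,n}$ the $m\times n$ zero matrix; $n,m,l\ge1$. A square matrix is Schur stable if its spectral radius is less than $1$. The power norm of a sequence $\mathbf{h}=(h_k)_{k\ge0}$ of complex vectors is given by $\|\mathbf{h}\|_p^2=\lim_{N\to\infty}\frac1N\sum_{k=0}^{N-1}h_k^*h_k$; in the infinite-dimensional problem only sequences $\mathbf{w}$ for which the limits defining $\|\mathbf{w}\|_p$ and the objective exist are admitted. $\mathcal{M}$ denotes the linear time-invariant system $x_{k+1}=Ax_k+Bw_k$, $z_k=Cx_k+Dw_k$. *)

theory Defs
  imports
    "Jordan_Normal_Form.Spectral_Radius"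
    "Jordan_Normal_Form.Schur_Decomposition"
begin

definition schur_stable :: "complex mat \<Rightarrow> bool" where
  "schur_stable A \<longleftrightarrow> square_mat A \<and> spectral_radius A < 1"

(* The block row [A B]; the block column is append_rows, written @\<^sub>r. *)
definition append_cols :: "complex mat \<Rightarrow> complex mat \<Rightarrow> complex mat" (infixr "@\<^sub>c" 65) where
  "A @\<^sub>c B = four_block_mat A B (0\<^sub>m 0 (dim_col A)) (0\<^sub>m 0 (dim_col B))"

definition mat_trace :: "complex mat \<Rightarrow> complex" where
  "mat_trace A = (\<Sum>i<dim_row A. A $$ (i, i))"

definition hermitian_mat :: "complex mat \<Rightarrow> bool" where
  "hermitian_mat V \<longleftrightarrow> square_mat V \<and> mat_adjoint V = V"

(* (V *\<^sub>v v) \<bullet>c v is v^* V v, which is real for Hermitian V. *)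
definition pos_semidef :: "complex mat \<Rightarrow> bool" where
  "pos_semidef V \<longleftrightarrow> hermitian_mat V \<and>
     (\<forall>v \<in> carrier_vec (dim_row V). 0 \<le> Re ((V *\<^sub>v v) \<bullet>c v))"

definition is_maximum :: "real set \<Rightarrow> real \<Rightarrow> bool" where
  "is_maximum S s \<longleftrightarrow> s \<in> S \<and> (\<forall>t \<in> S. t \<le> s)"


(* The traces below are real because V is Hermitian, so Re only changes the type. *)

definition sdp_feasible :: "nat \<Rightarrow> nat \<Rightarrow> complex mat \<Rightarrow> complex mat \<Rightarrow> complex mat \<Rightarrow> bool" where
  "sdp_feasible n m A B V \<longleftrightarrow>
     V \<in> carrier_mat (n + m) (n + m) \<and> hermitian_mat V \<and>
     (1\<^sub>m n @\<^sub>c 0\<^sub>m n m) * V * (1\<^sub>m n @\<^sub>r 0\<^sub>m m n)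
       = (A @\<^sub>c B) * V * (mat_adjoint A @\<^sub>r mat_adjoint B) \<and>
     Re (mat_trace ((0\<^sub>m m n @\<^sub>c 1\<^sub>m m) * V * mat_adjoint (0\<^sub>m m n @\<^sub>c 1\<^sub>m m))) \<le> 1 \<and>
     pos_semidef V"

definition sdp_objective :: "complex mat \<Rightarrow> complex mat \<Rightarrow> complex mat \<Rightarrow> real" where
  "sdp_objective C D V = Re (mat_trace ((C @\<^sub>c D) * V * mat_adjoint (C @\<^sub>c D)))"

definition sdp_values ::
    "nat \<Rightarrow> nat \<Rightarrow> complex mat \<Rightarrow> complex mat \<Rightarrow> complex mat \<Rightarrow> complex mat \<Rightarrow> real set" where
  "sdp_values n m A B C D = {sdp_objective C D V | V. sdp_feasible n m A B V}"

definition mu_opt ::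
    "nat \<Rightarrow> nat \<Rightarrow> complex mat \<Rightarrow> complex mat \<Rightarrow> complex mat \<Rightarrow> complex mat \<Rightarrow> real" where
  "mu_opt n m A B C D = Sup (sdp_values n m A B C D)"


(* h k \<bullet>c h k is h_k^* h_k, a nonnegative real. The value at N = 0 is irrelevant to limits. *)
definition avg_power :: "(nat \<Rightarrow> complex vec) \<Rightarrow> nat \<Rightarrow> real" where
  "avg_power h N = (1 / real N) * (\<Sum>k<N. Re (h k \<bullet>c h k))"

(* Meaningful only if avg_power h converges; lti_feasible demands this explicitly. *)
definition power_norm :: "(nat \<Rightarrow> complex vec) \<Rightarrow> real" where
  "power_norm h = sqrt (lim (avg_power h))"

definition lti_output :: "complex mat \<Rightarrow> complex mat \<Rightarrow>
    (nat \<Rightarrow> complex vec) \<Rightarrow> (nat \<Rightarrow> complex vec) \<Rightarrow> nat \<Rightarrow> complex vec" where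
  "lti_output C D w x k = C *\<^sub>v x k + D *\<^sub>v w k"

definition lti_feasible :: "nat \<Rightarrow> nat \<Rightarrow> complex mat \<Rightarrow> complex mat \<Rightarrow> complex mat \<Rightarrow> complex mat \<Rightarrow>
    (nat \<Rightarrow> complex vec) \<Rightarrow> (nat \<Rightarrow> complex vec) \<Rightarrow> bool" where
  "lti_feasible n m A B C D w x \<longleftrightarrow>
     (\<forall>k. w k \<in> carrier_vec m) \<and> (\<forall>k. x k \<in> carrier_vec n) \<and>
     x 0 = 0\<^sub>v n \<and> (\<forall>k. x (Suc k) = A *\<^sub>v x k + B *\<^sub>v w k) \<and>
     convergent (avg_power w) \<and> convergent (avg_power (lti_output C D w x)) \<and>
     power_norm w \<le> 1"

definition lti_values ::
    "nat \<Rightarrow> nat \<Rightarrow> complex mat \<Rightarrow> complex mat \<Rightarrow> complex mat \<Rightarrow> complex mat \<Rightarrow> real set" where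
  "lti_values n m A B C D =
     {lim (avg_power (lti_output C D w x)) | w x. lti_feasible n m A B C D w x}"

definition hinf_sq ::
    "nat \<Rightarrow> nat \<Rightarrow> complex mat \<Rightarrow> complex mat \<Rightarrow> complex mat \<Rightarrow> complex mat \<Rightarrow> real" where
  "hinf_sq n m A B C D = Sup (lti_values n m A B C D)"

end

theory Submission
  imports Defs "HOL-Analysis.Convex" "HOL-Analysis.Elementary_Metric_Spaces"
begin

text \<open>
Both optimal values are shown to be the largest output power of a single harmonic: the maximum of
\<open>|C x + D w|\<^sup>2\<close> over \<open>|w|\<^sup>2 \<le> 1\<close> and \<open>A x + B w = \<lambda> x\<close> with \<open>|\<lambda>| = 1\<close>.

From the infinite-dimensional problem to the semidefinite program, take an admitted trajectory and
form the averaged second moments \<open>V\<^sub>N = (1/N) \<Sum> v\<^sub>k v\<^sub>k\<^sup>*\<close>, where \<open>v\<^sub>k\<close> stacks state and input. The equality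
constraint telescopes, so \<open>V\<^sub>N\<close> violates it only by \<open>x\<^sub>N x\<^sub>N\<^sup>* / N\<close>, while the trace constraint and the
objective are the input and output powers up to time \<open>N\<close>. Stability bounds the average state power
by the average input power, so the \<open>V\<^sub>N\<close> are bounded and \<open>|x\<^sub>N|\<close> is bounded along a subsequence. A
further subsequence converges to a feasible point whose objective is the output power of the
trajectory (\<open>lti_values_subset_sdp_values\<close>). The same compactness argument shows that the
semidefinite program attains its maximum (\<open>sdp_values_closed\<close>, \<open>sdp_maximum_attained\<close>).

Conversely, a feasible \<open>V\<close> splits into feasible rank-one terms. Write \<open>V = S S\<^sup>*\<close>. The equality constraint
says that \<open>[I 0] S\<close> and \<open>[A B] S\<close> have the same Gram matrix of rows, hence differ by a unitary factor \<open>Q\<close>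
on the right. In an orthonormal eigenbasis of \<open>Q\<close> each column \<open>(x, w)\<close> of the rotated \<open>S\<close> satisfies
\<open>A x + B w = \<lambda> x\<close> with \<open>|\<lambda>| = 1\<close> (\<open>rank_one_decomposition\<close>). Objective and power are sums over the columns,
so for a maximal \<open>V\<close> some column has at least the optimal ratio of output to input power. After
scaling, the input \<open>\<lambda>\<^sup>k w\<close> started at the zero state produces \<open>x\<^sub>k = \<lambda>\<^sup>k x - A\<^sup>k x\<close>; the transient \<open>A\<^sup>k x\<close>
dies out, so this trajectory has the output power of the column (\<open>resonant_input_lti_value\<close>,
\<open>sdp_maximum_in_lti_values\<close>).
\<close>

section \<open>Inner products, norms and adjoints\<close>

definition sqnorm :: "complex vec \<Rightarrow> real" where
  "sqnorm v = (\<Sum>i<dim_vec v. (cmod (v $ i))\<^sup>2)"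

lemma cscalar_prod_self: "v \<bullet>c v = complex_of_real (sqnorm v)"
  by (simp add: sqnorm_def scalar_prod_def complex_norm_square[symmetric] atLeast0LessThan)

lemma Re_cscalar_prod_self: "Re (v \<bullet>c v) = sqnorm v"
  by (simp add: cscalar_prod_self)

lemma sqnorm_nonneg: "0 \<le> sqnorm v"
  by (simp add: sqnorm_def sum_nonneg)

lemma sqnorm_zero_vec [simp]: "sqnorm (0\<^sub>v p) = 0"
  by (simp add: sqnorm_def)

lemma sqnorm_eq_0D: "v \<in> carrier_vec p \<Longrightarrow> sqnorm v = 0 \<Longrightarrow> v = 0\<^sub>v p"
  by (intro eq_vecI) (auto simp: sqnorm_def sum_nonneg_eq_0_iff)

lemma sqnorm_smult: "sqnorm (c \<cdot>\<^sub>v v) = (cmod c)\<^sup>2 * sqnorm v"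
  by (simp add: sqnorm_def norm_mult power_mult_distrib sum_distrib_left)

lemma cmod_sq_le_sqnorm: "i < dim_vec v \<Longrightarrow> (cmod (v $ i))\<^sup>2 \<le> sqnorm v"
  unfolding sqnorm_def by (rule member_le_sum) auto

lemma cscalar_prod_swap:
  "v \<in> carrier_vec p \<Longrightarrow> w \<in> carrier_vec p \<Longrightarrow> w \<bullet>c v = cnj (v \<bullet>c (w :: complex vec))"
  by (auto simp: scalar_prod_def mult.commute)

lemma cscalar_prod_minus_left:
  "a \<in> carrier_vec p \<Longrightarrow> b \<in> carrier_vec p \<Longrightarrow> z \<in> carrier_vec p \<Longrightarrow>
   (a - b) \<bullet>c (z :: complex vec) = a \<bullet>c z - b \<bullet>c z"
  by (auto simp: scalar_prod_def sum_subtractf algebra_simps)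

lemma cscalar_prod_minus_right:
  "a \<in> carrier_vec p \<Longrightarrow> b \<in> carrier_vec p \<Longrightarrow> z \<in> carrier_vec p \<Longrightarrow>
   z \<bullet>c (a - b) = z \<bullet>c a - z \<bullet>c (b :: complex vec)"
  by (auto simp: scalar_prod_def sum_subtractf algebra_simps)

lemma cscalar_prod_smult_left:
  "a \<in> carrier_vec p \<Longrightarrow> z \<in> carrier_vec p \<Longrightarrow> (c \<cdot>\<^sub>v a) \<bullet>c z = c * (a \<bullet>c (z :: complex vec))"
  by (auto simp: scalar_prod_def sum_distrib_left algebra_simps)

lemma cscalar_prod_smult_right:
  "a \<in> carrier_vec p \<Longrightarrow> z \<in> carrier_vec p \<Longrightarrow> z \<bullet>c (c \<cdot>\<^sub>v a) = cnj c * (z \<bullet>c (a :: complex vec))"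
  by (auto simp: scalar_prod_def sum_distrib_left algebra_simps)

lemma cscalar_prod_smult_minus:
  assumes "y \<in> carrier_vec p" "z \<in> carrier_vec p" "d \<in> carrier_vec p"
  shows "(y - s \<cdot>\<^sub>v d) \<bullet>c (z - t \<cdot>\<^sub>v d) =
    y \<bullet>c z - cnj t * (y \<bullet>c d) - s * (d \<bullet>c z) + s * cnj t * (d \<bullet>c (d :: complex vec))"
proof -
note y = assms(1) and z = assms(2) and d = assms(3)
  have s: "s \<cdot>\<^sub>v d \<in> carrier_vec p" and t: "t \<cdot>\<^sub>v d \<in> carrier_vec p" and zt: "z - t \<cdot>\<^sub>v d \<in> carrier_vec p"
    using assms by auto
  have "(y - s \<cdot>\<^sub>v d) \<bullet>c (z - t \<cdot>\<^sub>v d) = (y \<bullet>c z - y \<bullet>c (t \<cdot>\<^sub>v d)) - s * (d \<bullet>c z - d \<bullet>c (t \<cdot>\<^sub>v d))"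
    unfolding cscalar_prod_minus_left[OF y s zt] cscalar_prod_smult_left[OF d zt]
      cscalar_prod_minus_right[OF z t y] cscalar_prod_minus_right[OF z t d] ..
  then show ?thesis
    unfolding cscalar_prod_smult_right[OF d y] cscalar_prod_smult_right[OF d d]
    by (simp only: right_diff_distrib) (simp add: mult.assoc)
qed

lemma mat_adjoint_index [simp]:
  "i < dim_col M \<Longrightarrow> j < dim_row M \<Longrightarrow> mat_adjoint M $$ (i, j) = conjugate (M $$ (j, i))"
  by (simp add: mat_adjoint_def mat_of_rows_index)

lemma mat_adjoint_dim [simp]:
  "dim_row (mat_adjoint M) = dim_col M" "dim_col (mat_adjoint M) = dim_row M"
  by (auto simp: mat_adjoint_def)

lemma mat_adjoint_carrier [simp]:
  "M \<in> carrier_mat r c \<Longrightarrow> mat_adjoint M \<in> carrier_mat c r"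
  by (intro carrier_matI) auto

lemma mat_adjoint_adjoint [simp]: "mat_adjoint (mat_adjoint M) = (M :: complex mat)"
  by (rule eq_matI) auto

lemma mat_adjoint_mult:
  assumes "M \<in> carrier_mat r k" "K \<in> carrier_mat k c"
  shows "mat_adjoint (M * K) = mat_adjoint K * mat_adjoint (M :: complex mat)"
  using assms by (intro eq_matI) (auto simp: scalar_prod_def mult.commute)

lemma mult_mat_adjoint_index:
  assumes "M \<in> carrier_mat r q" "K \<in> carrier_mat r' q" "i < r" "j < r'"
  shows "(M * mat_adjoint K) $$ (i, j) = (\<Sum>k<q. M $$ (i, k) * cnj (K $$ (j, k)))"
  using assms by (simp add: scalar_prod_def atLeast0LessThan)

lemma cscalar_prod_mult_mat_vec:
  assumes "M \<in> carrier_mat r c" "v \<in> carrier_vec c" "w \<in> carrier_vec r"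
  shows "(M *\<^sub>v v) \<bullet>c w = v \<bullet>c (mat_adjoint M *\<^sub>v (w :: complex vec))"
proof -
  have "(M *\<^sub>v v) \<bullet>c w = (\<Sum>i<r. (\<Sum>j<c. M $$ (i,j) * v $ j) * cnj (w $ i))"
    using assms by (simp add: scalar_prod_def atLeast0LessThan)
  also have "\<dots> = (\<Sum>i<r. \<Sum>j<c. v $ j * (cnj (w $ i) * M $$ (i,j)))"
    by (intro sum.cong refl) (simp add: sum_distrib_left mult.left_commute mult.commute)
  also have "\<dots> = (\<Sum>j<c. \<Sum>i<r. v $ j * (cnj (w $ i) * M $$ (i,j)))"
    by (rule sum.swap)
  also have "\<dots> = (\<Sum>j<c. v $ j * cnj (\<Sum>i<r. cnj (M $$ (i,j)) * w $ i))"
    by (simp add: sum_distrib_left mult.commute)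
  also have "\<dots> = v \<bullet>c (mat_adjoint M *\<^sub>v w)"
    using assms by (simp add: scalar_prod_def atLeast0LessThan)
  finally show ?thesis .
qed

section \<open>Unitary matrices and equal Gram matrices\<close>

definition unitary_mat :: "nat \<Rightarrow> complex mat \<Rightarrow> bool" where
  "unitary_mat p Z \<longleftrightarrow> Z \<in> carrier_mat p p \<and> mat_adjoint Z * Z = 1\<^sub>m p"

lemma unitary_matD:
  assumes "unitary_mat p Z"
  shows "Z \<in> carrier_mat p p" "mat_adjoint Z * Z = 1\<^sub>m p" "Z * mat_adjoint Z = 1\<^sub>m p"
proof -
  show Z: "Z \<in> carrier_mat p p" and Z': "mat_adjoint Z * Z = 1\<^sub>m p"
    using assms by (simp_all add: unitary_mat_def)
  show "Z * mat_adjoint Z = 1\<^sub>m p"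
    by (rule mat_mult_left_right_inverse[OF mat_adjoint_carrier[OF Z] Z Z'])
qed

lemma unitary_mat_adjoint: "unitary_mat p Z \<Longrightarrow> unitary_mat p (mat_adjoint Z)"
  using mat_adjoint_carrier unitary_matD unfolding unitary_mat_def by simp

lemma unitary_mat_cscalar_prod:
  assumes "unitary_mat p Z" "v \<in> carrier_vec p" "w \<in> carrier_vec p"
  shows "(Z *\<^sub>v v) \<bullet>c (Z *\<^sub>v w) = v \<bullet>c w"
proof -
  note Z = unitary_matD[OF assms(1)]
  have "(Z *\<^sub>v v) \<bullet>c (Z *\<^sub>v w) = v \<bullet>c (mat_adjoint Z *\<^sub>v (Z *\<^sub>v w))"
    by (rule cscalar_prod_mult_mat_vec[of _ p p]) (use Z assms in auto)
  also have "mat_adjoint Z *\<^sub>v (Z *\<^sub>v w) = w"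
    using assoc_mult_mat_vec[of "mat_adjoint Z" p p Z p w] Z assms by auto
  finally show ?thesis .
qed

lemma unitary_matI:
  assumes Z: "Z \<in> carrier_mat p p"
    and orth: "\<And>i j. i < p \<Longrightarrow> j < p \<Longrightarrow> col Z j \<bullet>c col Z i = (if i = j then 1 else 0)"
  shows "unitary_mat p Z"
  unfolding unitary_mat_def
proof (intro conjI Z eq_matI)
  fix i j assume ij: "i < dim_row (1\<^sub>m p :: complex mat)" "j < dim_col (1\<^sub>m p :: complex mat)"
  then have "(mat_adjoint Z * Z) $$ (i, j) = col Z j \<bullet>c col Z i"
    using Z by (auto simp: scalar_prod_def mult.commute)
  then show "(mat_adjoint Z * Z) $$ (i, j) = 1\<^sub>m p $$ (i, j)"
    using orth[of i j] ij by auto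
qed (use Z in auto)

lemma col_mult_unit_vec: "(M :: complex mat) \<in> carrier_mat r c \<Longrightarrow> j < c \<Longrightarrow> col M j = M *\<^sub>v unit_vec c j"
  by (intro eq_vecI) (auto simp: scalar_prod_right_unit[of _ c])

lemma unit_vec_cscalar_prod:
  "i < p \<Longrightarrow> j < p \<Longrightarrow> unit_vec p j \<bullet>c (unit_vec p i :: complex vec) = (if i = j then 1 else 0)"
  by (subst scalar_prod_left_unit) auto

text \<open>
The columns are the images of the standard basis, so preserving inner products makes them
orthonormal.
\<close>
lemma unitary_mat_if_isometry:
  assumes Z: "Z \<in> carrier_mat p p"
    and iso: "\<And>v w. v \<in> carrier_vec p \<Longrightarrow> w \<in> carrier_vec p \<Longrightarrow> (Z *\<^sub>v v) \<bullet>c (Z *\<^sub>v w) = v \<bullet>c w"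
  shows "unitary_mat p Z"
  by (rule unitary_matI[OF Z]) (simp add: col_mult_unit_vec[OF Z] iso unit_vec_cscalar_prod)

lemma unitary_mat_mult:
  assumes "unitary_mat p Z" "unitary_mat p W"
  shows "unitary_mat p (Z * W)"
proof (rule unitary_mat_if_isometry)
  note Z = unitary_matD(1)[OF assms(1)] and W = unitary_matD(1)[OF assms(2)]
  show "Z * W \<in> carrier_mat p p" using Z W by auto
  fix v w :: "complex vec" assume v: "v \<in> carrier_vec p" "w \<in> carrier_vec p"
  have "(Z * W *\<^sub>v v) \<bullet>c (Z * W *\<^sub>v w) = (Z *\<^sub>v (W *\<^sub>v v)) \<bullet>c (Z *\<^sub>v (W *\<^sub>v w))"
    by (simp only: assoc_mult_mat_vec[OF Z W v(1)] assoc_mult_mat_vec[OF Z W v(2)])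
  also have "\<dots> = v \<bullet>c w"
    by (subst unitary_mat_cscalar_prod[OF assms(1)], use W v in simp, use W v in simp,
        rule unitary_mat_cscalar_prod[OF assms(2) v])
  finally show "(Z * W *\<^sub>v v) \<bullet>c (Z * W *\<^sub>v w) = v \<bullet>c w" .
qed

lemma unitary_mat_one: "unitary_mat p (1\<^sub>m p)"
  by (rule unitary_mat_if_isometry) auto

text \<open>
For \<open>d = a - b\<close> the reflection-like map \<open>y \<mapsto> y - \<tau> \<langle>y, d\<rangle> d\<close> with \<open>\<tau> = 1 / \<langle>a, d\<rangle>\<close> sends \<open>a\<close> to \<open>b\<close>. Over the
complex numbers \<open>\<tau>\<close> need not be real; unitarity amounts to \<open>\<tau> + \<tau>\<^sup>* = |\<tau>|\<^sup>2 |d|\<^sup>2\<close>, which follows from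
\<open>2 Re \<langle>a, d\<rangle> = |d|\<^sup>2\<close> and so from the equality of the norms.
\<close>
lemma householder:
  assumes a: "a \<in> carrier_vec p" and b: "b \<in> carrier_vec p" and eq: "sqnorm a = sqnorm b"
  shows "\<exists>Z. unitary_mat p Z \<and> Z *\<^sub>v a = b \<and>
    (\<forall>y \<in> carrier_vec p. y \<bullet>c (a - b) = 0 \<longrightarrow> Z *\<^sub>v y = y)"
proof (cases "a = b")
  case True
  then show ?thesis using a by (intro exI[of _ "1\<^sub>m p"]) (auto simp: unitary_mat_one)
next
  case False
  define d where "d = a - b"
  have d: "d \<in> carrier_vec p" using a b by (simp add: d_def)
  define s where "s = a \<bullet>c d"
  \<comment> \<open>This is where the equality of the norms enters: it gives \<open>2 Re \<langle>a, d\<rangle> = |d|\<^sup>2\<close>, so also \<open>s \<noteq> 0\<close>.\<close>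
  have s_sum: "s + cnj s = d \<bullet>c d"
  proof -
    have ab: "a - b \<in> carrier_vec p" using a b by simp
    have "s = a \<bullet>c a - a \<bullet>c b" unfolding s_def d_def by (rule cscalar_prod_minus_right) (use a b in auto)
    moreover have "d \<bullet>c d = (a \<bullet>c a - a \<bullet>c b) - (b \<bullet>c a - b \<bullet>c b)"
      unfolding d_def
      unfolding cscalar_prod_minus_left[OF a b ab] cscalar_prod_minus_right[OF a b a]
        cscalar_prod_minus_right[OF a b b] ..
    moreover have "b \<bullet>c a = cnj (a \<bullet>c b)" by (rule cscalar_prod_swap[OF a b])
    ultimately show ?thesis using eq by (simp add: cscalar_prod_self)
  qed
  have "d \<noteq> 0\<^sub>v p"
  proof
    assume "d = 0\<^sub>v p"
    then have "a $ i = b $ i" if "i < p" for i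
      using that b index_minus_vec(1)[of i b a] by (simp add: d_def)
    with a b False show False by (metis carrier_vecD eq_vecI)
  qed
  then have s0: "s \<noteq> 0" using s_sum d by auto
  define t where "t = 1 / s"
  define Z where "Z = mat p p (\<lambda>(i,j). (if i = j then 1 else 0) - t * d $ i * cnj (d $ j))"
  have Z: "Z \<in> carrier_mat p p" by (simp add: Z_def)
  have Zv: "Z *\<^sub>v y = y - (t * (y \<bullet>c d)) \<cdot>\<^sub>v d" if y: "y \<in> carrier_vec p" for y
  proof (rule eq_vecI)
    fix i assume "i < dim_vec (y - (t * (y \<bullet>c d)) \<cdot>\<^sub>v d)"
    then have i: "i < p" using d by simp
    then have "(Z *\<^sub>v y) $ i = (\<Sum>j<p. ((if i = j then 1 else 0) - t * d $ i * cnj (d $ j)) * y $ j)"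
      using y d by (simp add: Z_def scalar_prod_def atLeast0LessThan)
    also have "\<dots> = (\<Sum>j<p. (if i = j then y $ j else 0)) - (\<Sum>j<p. t * d $ i * cnj (d $ j) * y $ j)"
      unfolding sum_subtractf[symmetric] by (rule sum.cong) (auto simp: algebra_simps)
    also have "\<dots> = y $ i - (t * (y \<bullet>c d)) * d $ i"
      using i y d by (simp add: scalar_prod_def atLeast0LessThan sum_distrib_left sum_distrib_right ac_simps)
    finally show "(Z *\<^sub>v y) $ i = (y - (t * (y \<bullet>c d)) \<cdot>\<^sub>v d) $ i"
      using i y d by simp
  qed (use Z d in auto)
  have unit_cond: "t + cnj t = t * cnj t * (d \<bullet>c d)"
    using s0 s_sum[symmetric] by (simp add: t_def field_simps)
  have "unitary_mat p Z"
  proof (rule unitary_mat_if_isometry[OF Z])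
    fix v w :: "complex vec" assume v: "v \<in> carrier_vec p" and w: "w \<in> carrier_vec p"
    have dw: "d \<bullet>c w = cnj (w \<bullet>c d)" by (rule cscalar_prod_swap[OF w d])
    have "(Z *\<^sub>v v) \<bullet>c (Z *\<^sub>v w) = v \<bullet>c w
        - (v \<bullet>c d) * cnj (w \<bullet>c d) * (t + cnj t - t * cnj t * (d \<bullet>c d))"
      unfolding Zv[OF v] Zv[OF w] cscalar_prod_smult_minus[OF v w d] dw
      by (simp add: algebra_simps)
    also have "\<dots> = v \<bullet>c w" using unit_cond by simp
    finally show "(Z *\<^sub>v v) \<bullet>c (Z *\<^sub>v w) = v \<bullet>c w" .
  qed
  moreover have "Z *\<^sub>v a = b"
  proof -
    have "t * (a \<bullet>c d) = 1" using s0 by (simp add: t_def s_def[symmetric])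
    then show ?thesis unfolding Zv[OF a] using a b by (intro eq_vecI) (auto simp: d_def)
  qed
  moreover have "Z *\<^sub>v y = y" if "y \<in> carrier_vec p" "y \<bullet>c (a - b) = 0" for y
    unfolding Zv[OF that(1)] using that d by (intro eq_vecI) (auto simp: d_def[symmetric])
  ultimately show ?thesis by blast
qed

text \<open>
The vectors are matched one at a time. Once \<open>f 0, ..., f (k - 1)\<close> are in place, the image of \<open>f k\<close> and
the target \<open>g k\<close> have equal norms and equal inner products with every earlier \<open>g i\<close>. Their difference is
thus orthogonal to the earlier targets, and the Householder map that moves one to the other leaves
these fixed.
\<close>
lemma unitary_of_equal_gram:
  fixes k :: nat
  assumes "\<forall>i<k. f i \<in> carrier_vec p" "\<forall>i<k. g i \<in> carrier_vec p"
    and "\<forall>i<k. \<forall>j<k. f i \<bullet>c f j = g i \<bullet>c (g j :: complex vec)"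
  shows "\<exists>Z. unitary_mat p Z \<and> (\<forall>i<k. Z *\<^sub>v f i = g i)"
  using assms
proof (induction k)
  case 0
  then show ?case using unitary_mat_one by auto
next
  case (Suc k)
  from Suc.IH Suc.prems obtain Z where Z: "unitary_mat p Z" and Zf: "\<forall>i<k. Z *\<^sub>v f i = g i"
    by (auto simp: less_Suc_eq)
  note Zc = unitary_matD(1)[OF Z]
  have fk: "f k \<in> carrier_vec p" and gk: "g k \<in> carrier_vec p" using Suc.prems by auto
  have a: "Z *\<^sub>v f k \<in> carrier_vec p" using Zc fk by auto
  have "complex_of_real (sqnorm (Z *\<^sub>v f k)) = complex_of_real (sqnorm (g k))"
    unfolding cscalar_prod_self[symmetric] unitary_mat_cscalar_prod[OF Z fk fk]
    using Suc.prems(3) by simp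
  then obtain W where W: "unitary_mat p W" and Wa: "W *\<^sub>v (Z *\<^sub>v f k) = g k"
    and Wy: "\<And>y. y \<in> carrier_vec p \<Longrightarrow> y \<bullet>c (Z *\<^sub>v f k - g k) = 0 \<Longrightarrow> W *\<^sub>v y = y"
    using householder[OF a gk] by auto
  have "(W * Z) *\<^sub>v f i = g i" if i: "i < Suc k" for i
  proof -
    have fi: "f i \<in> carrier_vec p" and gi: "g i \<in> carrier_vec p" using Suc.prems i by auto
    have eq: "(W * Z) *\<^sub>v f i = W *\<^sub>v (Z *\<^sub>v f i)"
      by (rule assoc_mult_mat_vec[OF unitary_matD(1)[OF W] Zc fi])
    show ?thesis
    proof (cases "i = k")
      case True then show ?thesis using eq Wa by simp
    next
      case False
      then have Zi: "Z *\<^sub>v f i = g i" using Zf i by auto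
      have "g i \<bullet>c (Z *\<^sub>v f k - g k) = (Z *\<^sub>v f i) \<bullet>c (Z *\<^sub>v f k) - g i \<bullet>c g k"
        unfolding Zi by (rule cscalar_prod_minus_right[OF a gk gi])
      also have "\<dots> = 0"
        using unitary_mat_cscalar_prod[OF Z fi fk] Suc.prems(3) i by simp
      finally show ?thesis using eq Zi Wy[OF gi] by simp
    qed
  qed
  then show ?case using unitary_mat_mult[OF W Z] by blast
qed

text \<open>
The Gram matrix of the rows is \<open>X X\<^sup>*\<close>, and acting on rows from the right is acting on their
conjugates from the left by the adjoint.
\<close>
lemma unitary_factor_of_equal_gram:
  fixes X Y :: "complex mat"
  assumes X: "X \<in> carrier_mat n p" and Y: "Y \<in> carrier_mat n p"
    and eq: "X * mat_adjoint X = Y * mat_adjoint Y"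
  shows "\<exists>Q. unitary_mat p Q \<and> Y = X * Q"
proof -
  have gram: "conjugate (row M i) \<bullet>c conjugate (row M j) = cnj ((M * mat_adjoint M) $$ (i, j))"
    if "M \<in> carrier_mat n p" "i < n" "j < n" for M i j
    using that by (auto simp: scalar_prod_def)
  obtain Z where Z: "unitary_mat p Z"
    and ZX: "\<And>i. i < n \<Longrightarrow> Z *\<^sub>v conjugate (row X i) = conjugate (row Y i)"
    using unitary_of_equal_gram[of n "\<lambda>i. conjugate (row X i)" p "\<lambda>i. conjugate (row Y i)"]
      X Y gram[OF X] gram[OF Y] eq by auto
  note Zc = unitary_matD(1)[OF Z]
  have "Y = X * mat_adjoint Z"
  proof (rule eq_matI)
    fix i j assume "i < dim_row (X * mat_adjoint Z)" "j < dim_col (X * mat_adjoint Z)"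
    then have i: "i < n" and j: "j < p" using X Zc by auto
    have "cnj (Y $$ (i,j)) = (Z *\<^sub>v conjugate (row X i)) $ j"
      unfolding ZX[OF i] using i j Y by simp
    also have "\<dots> = cnj ((X * mat_adjoint Z) $$ (i, j))"
      using i j X Zc by (auto simp: scalar_prod_def mult.commute)
    finally show "Y $$ (i, j) = (X * mat_adjoint Z) $$ (i, j)" by simp
  qed (use X Y Zc in auto)
  with unitary_mat_adjoint[OF Z] show ?thesis by blast
qed

section \<open>Unitary diagonalization of normal matrices\<close>

text \<open>
Deflation: a unitary matrix sending the first unit vector to a unit eigenvector conjugates \<open>N\<close> into a
matrix whose first column is a multiple of the first unit vector. By normality the first row has the
same norm as the first column, so it vanishes off the diagonal as well, and the remaining block is
again normal.
\<close>
lemma normal_mat_orthonormal_eigenvectors: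
  fixes N :: "complex mat"
  assumes "N \<in> carrier_mat p p" "N * mat_adjoint N = mat_adjoint N * N"
  shows "\<exists>e d. \<forall>i<p. e i \<in> carrier_vec p \<and> N *\<^sub>v e i = d i \<cdot>\<^sub>v e i \<and>
    (\<forall>j<p. e i \<bullet>c e j = (if i = j then 1 else 0))"
  using assms
proof (induction p arbitrary: N)
  case 0
  then show ?case by simp
next
  case (Suc p)
  note N = Suc.prems(1) and normal = Suc.prems(2)
  have N': "mat_adjoint N \<in> carrier_mat (Suc p) (Suc p)" using N by simp
  obtain ev where "ev \<in> spectrum N" using spectrum_non_empty[OF N] by auto
  then obtain u where "eigenvector N u ev"
    by (auto simp: spectrum_def eigenvalue_def)
  then have u: "u \<in> carrier_vec (Suc p)" and u0: "u \<noteq> 0\<^sub>v (Suc p)" and Nu: "N *\<^sub>v u = ev \<cdot>\<^sub>v u"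
    using N by (auto simp: eigenvector_def)
  have u_pos: "sqnorm u > 0"
    using sqnorm_eq_0D[OF u] u0 sqnorm_nonneg[of u] by fastforce
  define v where "v = complex_of_real (1 / sqrt (sqnorm u)) \<cdot>\<^sub>v u"
  have v: "v \<in> carrier_vec (Suc p)" using u by (simp add: v_def)
  have v1: "sqnorm v = 1"
    using u_pos by (simp add: v_def sqnorm_smult norm_divide power_divide)
  have Nv: "N *\<^sub>v v = ev \<cdot>\<^sub>v v"
    unfolding v_def using N u Nu by (simp add: mult_mat_vec smult_smult_assoc mult.commute)
  let ?e0 = "unit_vec (Suc p) 0 :: complex vec"
  have "sqnorm ?e0 = sqnorm v"
    using unit_vec_cscalar_prod[of 0 "Suc p" 0] v1 by (simp add: cscalar_prod_self del: scalar_prod_left_unit scalar_prod_right_unit)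
  then obtain W where W: "unitary_mat (Suc p) W" and We0: "W *\<^sub>v ?e0 = v"
    using householder[of ?e0 "Suc p" v] v by auto
  note Wc = unitary_matD(1)[OF W] and W'W = unitary_matD(2)[OF W] and WW' = unitary_matD(3)[OF W]
  have W'c: "mat_adjoint W \<in> carrier_mat (Suc p) (Suc p)" using Wc by simp
  \<comment> \<open>In the basis given by W the matrix N splits off its eigenvector.\<close>
  define B where "B = mat_adjoint W * (N * W)"
  have NW: "N * W \<in> carrier_mat (Suc p) (Suc p)" and N'W: "mat_adjoint N * W \<in> carrier_mat (Suc p) (Suc p)"
    using N N' Wc by auto
  have B: "B \<in> carrier_mat (Suc p) (Suc p)" using W'c NW by (simp add: B_def)
  have cancel: "W * (mat_adjoint W * M) = M" if "M \<in> carrier_mat (Suc p) (Suc p)" for M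
    using assoc_mult_mat[OF Wc W'c that] WW' that by simp
  have WB: "W * B = N * W" unfolding B_def by (rule cancel[OF NW])
  have B': "mat_adjoint B = mat_adjoint W * (mat_adjoint N * W)"
    unfolding B_def mat_adjoint_mult[OF W'c NW] mat_adjoint_mult[OF N Wc] mat_adjoint_adjoint
    by (rule assoc_mult_mat[OF W'c N' Wc])
  have B'c: "mat_adjoint B \<in> carrier_mat (Suc p) (Suc p)" using B by simp
  have WB': "W * mat_adjoint B = mat_adjoint N * W" unfolding B' by (rule cancel[OF N'W])
  have "B * mat_adjoint B = mat_adjoint W * ((N * mat_adjoint N) * W)"
    unfolding B_def assoc_mult_mat[OF W'c NW B'c[unfolded B_def]]
      assoc_mult_mat[OF N Wc B'c[unfolded B_def]] WB'[unfolded B_def] assoc_mult_mat[OF N N' Wc] ..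
  also have "\<dots> = mat_adjoint W * (mat_adjoint N * (N * W))"
    unfolding normal assoc_mult_mat[OF N' N Wc] ..
  also have "\<dots> = mat_adjoint B * B"
    unfolding B' assoc_mult_mat[OF W'c N'W B] assoc_mult_mat[OF N' Wc B] WB ..
  finally have Bnormal: "B * mat_adjoint B = mat_adjoint B * B" .
  have "B *\<^sub>v ?e0 = mat_adjoint W *\<^sub>v (N *\<^sub>v (W *\<^sub>v ?e0))"
    unfolding B_def using W'c NW N Wc by (simp add: assoc_mult_mat_vec[of _ "Suc p" "Suc p" _ "Suc p"])
  also have "\<dots> = ev \<cdot>\<^sub>v (mat_adjoint W *\<^sub>v (W *\<^sub>v ?e0))"
    unfolding We0 Nv using W'c v by (simp add: mult_mat_vec)
  also have "mat_adjoint W *\<^sub>v (W *\<^sub>v ?e0) = ?e0"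
    using assoc_mult_mat_vec[OF W'c Wc, of ?e0] W'W by simp
  finally have Be0: "col B 0 = ev \<cdot>\<^sub>v ?e0" unfolding col_mult_unit_vec[OF B zero_less_Suc] .
  have B0: "B $$ (i, 0) = (if i = 0 then ev else 0)" if "i < Suc p" for i
    using arg_cong[OF Be0, of "\<lambda>v. v $ i"] that B by auto
  have Bsum: "(\<Sum>k<Suc p. B $$ (i, k) * cnj (B $$ (j, k))) = (\<Sum>k<Suc p. cnj (B $$ (k, i)) * B $$ (k, j))"
    if "i < Suc p" "j < Suc p" for i j
    using arg_cong[OF Bnormal, of "\<lambda>M. M $$ (i, j)"] that B
    by (auto simp: scalar_prod_def atLeast0LessThan)
  \<comment> \<open>Comparing the top left entries of \<open>B B\<^sup>*\<close> and \<open>B\<^sup>* B\<close> clears the rest of the first row.\<close>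
  have "(\<Sum>k<p. B $$ (0, Suc k) * cnj (B $$ (0, Suc k))) = 0"
    using Bsum[of 0 0] unfolding sum.lessThan_Suc_shift by (simp add: B0 mult.commute)
  then have "complex_of_real (\<Sum>k<p. (cmod (B $$ (0, Suc k)))\<^sup>2) = 0"
    by (simp add: complex_norm_square[symmetric])
  then have "(\<Sum>k<p. (cmod (B $$ (0, Suc k)))\<^sup>2) = 0" by (simp only: of_real_eq_0_iff)
  then have B0': "B $$ (0, Suc k) = 0" if "k < p" for k
    using that by (subst (asm) sum_nonneg_eq_0_iff) auto
  define M where "M = mat p p (\<lambda>(i,j). B $$ (Suc i, Suc j))"
  have M: "M \<in> carrier_mat p p" by (simp add: M_def)
  have "M * mat_adjoint M = mat_adjoint M * M"
  proof (rule eq_matI)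
    fix i j assume "i < dim_row (mat_adjoint M * M)" "j < dim_col (mat_adjoint M * M)"
    then have ij: "i < p" "j < p" using M by auto
    have "(\<Sum>k<p. B $$ (Suc i, Suc k) * cnj (B $$ (Suc j, Suc k))) =
      (\<Sum>k<p. cnj (B $$ (Suc k, Suc i)) * B $$ (Suc k, Suc j))"
      using Bsum[of "Suc i" "Suc j"] ij B0 B0' unfolding sum.lessThan_Suc_shift by simp
    then show "(M * mat_adjoint M) $$ (i, j) = (mat_adjoint M * M) $$ (i, j)"
      using ij by (auto simp: M_def scalar_prod_def atLeast0LessThan)
  qed (use M in auto)
  then obtain f d where f: "\<And>i. i < p \<Longrightarrow> f i \<in> carrier_vec p"
    and Mf: "\<And>i. i < p \<Longrightarrow> M *\<^sub>v f i = d i \<cdot>\<^sub>v f i"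
    and orth: "\<And>i j. i < p \<Longrightarrow> j < p \<Longrightarrow> f i \<bullet>c f j = (if i = j then 1 else 0)"
    using Suc.IH[OF M] by blast
  have BvCons: "B *\<^sub>v vCons 0 y = vCons 0 (M *\<^sub>v y)" if y: "y \<in> carrier_vec p" for y
  proof (rule eq_vecI)
    fix i assume "i < dim_vec (vCons 0 (M *\<^sub>v y))"
    then have i: "i < Suc p" using M by simp
    have "(B *\<^sub>v vCons 0 y) $ i = (\<Sum>k<p. B $$ (i, Suc k) * y $ k)"
      using i B y by (auto simp: scalar_prod_def atLeast0LessThan sum.lessThan_Suc_shift simp del: sum.lessThan_Suc)
    also have "\<dots> = vCons 0 (M *\<^sub>v y) $ i"
      using i y B0' by (cases i) (auto simp: M_def scalar_prod_def atLeast0LessThan)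
    finally show "(B *\<^sub>v vCons 0 y) $ i = vCons 0 (M *\<^sub>v y) $ i" .
  qed (use B M in auto)
  define g where "g i = (case i of 0 \<Rightarrow> ?e0 | Suc k \<Rightarrow> vCons 0 (f k))" for i
  define c where "c i = (case i of 0 \<Rightarrow> ev | Suc k \<Rightarrow> d k)" for i
  have g: "g i \<in> carrier_vec (Suc p)" if "i < Suc p" for i
    using that f by (auto simp: g_def split: nat.splits)
  have e0: "?e0 = vCons 1 (0\<^sub>v p)"
    by (rule eq_vecI) (auto simp: vec_index_vCons)
  have g_orth: "g i \<bullet>c g j = (if i = j then 1 else 0)" if "i < Suc p" "j < Suc p" for i j
    unfolding g_def e0 using that f orth by (auto split: nat.splits)
  have Bg: "B *\<^sub>v g i = c i \<cdot>\<^sub>v g i" if i: "i < Suc p" for i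
  proof (cases i)
    case 0
    then show ?thesis using Be0 col_mult_unit_vec[OF B zero_less_Suc] by (simp add: g_def c_def)
  next
    case (Suc k)
    have "vCons 0 (d k \<cdot>\<^sub>v f k) = d k \<cdot>\<^sub>v vCons 0 (f k)"
      by (rule eq_vecI) (auto simp: vec_index_vCons)
    then show ?thesis using Suc i f Mf BvCons by (simp add: g_def c_def)
  qed
  show ?case
  proof (intro exI allI impI conjI)
    fix i assume i: "i < Suc p"
    show "W *\<^sub>v g i \<in> carrier_vec (Suc p)" using Wc g[OF i] by simp
    have "N *\<^sub>v (W *\<^sub>v g i) = W *\<^sub>v (B *\<^sub>v g i)"
      using assoc_mult_mat_vec[OF N Wc g[OF i]] assoc_mult_mat_vec[OF Wc B g[OF i]] WB by simp
    then show "N *\<^sub>v (W *\<^sub>v g i) = c i \<cdot>\<^sub>v (W *\<^sub>v g i)"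
      using Bg[OF i] Wc g[OF i] by (simp add: mult_mat_vec)
    fix j assume j: "j < Suc p"
    show "(W *\<^sub>v g i) \<bullet>c (W *\<^sub>v g j) = (if i = j then 1 else 0)"
      using unitary_mat_cscalar_prod[OF W g[OF i] g[OF j]] g_orth[OF i j] by simp
  qed
qed

theorem normal_mat_unitary_diagonalization:
  fixes N :: "complex mat"
  assumes "N \<in> carrier_mat p p" "N * mat_adjoint N = mat_adjoint N * N"
  shows "\<exists>P d. unitary_mat p P \<and> (\<forall>j<p. N *\<^sub>v col P j = d j \<cdot>\<^sub>v col P j)"
proof -
  obtain e d where e: "\<forall>i<p. e i \<in> carrier_vec p \<and> N *\<^sub>v e i = d i \<cdot>\<^sub>v e i \<and>
    (\<forall>j<p. e i \<bullet>c e j = (if i = j then 1 else 0))"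
    using normal_mat_orthonormal_eigenvectors[OF assms] by blast
  define P where "P = mat p p (\<lambda>(i,j). e j $ i)"
  have col: "col P j = e j" if "j < p" for j
    using that e by (intro eq_vecI) (auto simp: P_def)
  have "unitary_mat p P"
    by (rule unitary_matI) (use e col in \<open>auto simp: P_def\<close>)
  moreover have "\<forall>j<p. N *\<^sub>v col P j = d j \<cdot>\<^sub>v col P j" using e col by simp
  ultimately show ?thesis by blast
qed

section \<open>Rank-one decomposition of positive semidefinite matrices\<close>

lemma cscalar_prod_eq_1_sqnorm: "v \<bullet>c v = 1 \<Longrightarrow> sqnorm v = 1"
  by (simp add: cscalar_prod_self)

lemma unitary_mat_sqnorm_col: "unitary_mat p P \<Longrightarrow> j < p \<Longrightarrow> sqnorm (col P j) = 1"
  by (rule cscalar_prod_eq_1_sqnorm)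
    (simp add: col_mult_unit_vec[OF unitary_matD(1)] unitary_mat_cscalar_prod unit_vec_cscalar_prod
      del: scalar_prod_left_unit scalar_prod_right_unit)

text \<open>
With \<open>V = P diag(d) P\<^sup>*\<close>, the factor is \<open>S = P diag(\<surd>d)\<close>.
\<close>
lemma pos_semidef_factor:
  assumes V: "V \<in> carrier_mat p p" and psd: "pos_semidef V"
  shows "\<exists>S \<in> carrier_mat p p. V = S * mat_adjoint S"
proof -
  have herm: "mat_adjoint V = V" using psd by (simp add: pos_semidef_def hermitian_mat_def)
  obtain P d where P: "unitary_mat p P" and VP: "\<And>j. j < p \<Longrightarrow> V *\<^sub>v col P j = d j \<cdot>\<^sub>v col P j"
    using normal_mat_unitary_diagonalization[OF V] herm by auto
  note Pc = unitary_matD(1)[OF P]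
  \<comment> \<open>The quadratic form of \<open>V\<close> at a unit eigenvector is the eigenvalue.\<close>
  have d_real: "d j = complex_of_real (Re (d j))" "0 \<le> Re (d j)" if j: "j < p" for j
  proof -
    have c: "col P j \<in> carrier_vec p" using Pc by auto
    have cc: "col P j \<bullet>c col P j = 1"
      using unitary_mat_sqnorm_col[OF P j] by (simp add: cscalar_prod_self)
    have dj: "(V *\<^sub>v col P j) \<bullet>c col P j = d j"
      unfolding VP[OF j] cscalar_prod_smult_left[OF c c] cc by simp
    have dj': "col P j \<bullet>c (V *\<^sub>v col P j) = cnj (d j)"
      unfolding VP[OF j] cscalar_prod_smult_right[OF c c] cc by simp
    have "d j = cnj (d j)"
      using cscalar_prod_mult_mat_vec[OF V c c] unfolding herm dj dj' .
    then show "d j = complex_of_real (Re (d j))" by (simp add: complex_eq_iff)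
    show "0 \<le> Re (d j)"
      using psd c V dj unfolding pos_semidef_def by force
  qed
  define S where "S = mat p p (\<lambda>(i,j). complex_of_real (sqrt (Re (d j))) * P $$ (i,j))"
  have S: "S \<in> carrier_mat p p" by (simp add: S_def)
  have VPc: "V * P \<in> carrier_mat p p" using V Pc by simp
  have "V = (V * P) * mat_adjoint P"
    using assoc_mult_mat[OF V Pc mat_adjoint_carrier[OF Pc]] unitary_matD(3)[OF P] V by simp
  also have "\<dots> = S * mat_adjoint S"
  proof (rule eq_matI)
    fix a b assume "a < dim_row (S * mat_adjoint S)" "b < dim_col (S * mat_adjoint S)"
    then have ab: "a < p" "b < p" using S by auto
    have VPi: "(V * P) $$ (a, j) = d j * P $$ (a, j)" if "j < p" for j
      using arg_cong[OF VP[OF that], of "\<lambda>v. v $ a"] ab that V Pc by simp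
    have "((V * P) * mat_adjoint P) $$ (a, b) = (\<Sum>j<p. (V * P) $$ (a, j) * cnj (P $$ (b, j)))"
      by (rule mult_mat_adjoint_index[OF VPc Pc ab])
    also have "\<dots> = (\<Sum>j<p. S $$ (a, j) * cnj (S $$ (b, j)))"
    proof (rule sum.cong[OF refl])
      fix j assume "j \<in> {..<p}"
      then have j: "j < p" by simp
      have "complex_of_real (sqrt (Re (d j))) * complex_of_real (sqrt (Re (d j))) = d j"
        using d_real[OF j] by (simp flip: of_real_mult)
      then show "(V * P) $$ (a, j) * cnj (P $$ (b, j)) = S $$ (a, j) * cnj (S $$ (b, j))"
        unfolding VPi[OF j] using ab j by (simp add: S_def)
    qed
    also have "\<dots> = (S * mat_adjoint S) $$ (a, b)"
      by (rule mult_mat_adjoint_index[OF S S ab, symmetric])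
    finally show "((V * P) * mat_adjoint P) $$ (a, b) = (S * mat_adjoint S) $$ (a, b)" .
  qed (use V Pc S in simp_all)
  finally show ?thesis using S by blast
qed

text \<open>
If \<open>V = S S\<^sup>*\<close>, the constraint makes the rows of \<open>E S\<close> and \<open>F S\<close> have the same Gram matrix, so
\<open>F S = E S Q\<close> with \<open>Q\<close> unitary. Replacing \<open>S\<close> by \<open>S P\<close>, where \<open>P\<close> diagonalizes \<open>Q\<close>, leaves \<open>V\<close> unchanged and
turns \<open>Q\<close> into a diagonal matrix of unimodular numbers.
\<close>
lemma rank_one_decomposition:
  assumes E: "E \<in> carrier_mat r p" and F: "F \<in> carrier_mat r p"
    and V: "V \<in> carrier_mat p p" and psd: "pos_semidef V"
    and eq: "E * V * mat_adjoint E = F * V * mat_adjoint F"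
  shows "\<exists>T \<in> carrier_mat p p. V = T * mat_adjoint T \<and>
    (\<forall>j<p. \<exists>c. cmod c = 1 \<and> F *\<^sub>v col T j = c \<cdot>\<^sub>v (E *\<^sub>v col T j))"
proof -
  obtain S where S: "S \<in> carrier_mat p p" and VS: "V = S * mat_adjoint S"
    using pos_semidef_factor[OF V psd] by blast
  note S' = mat_adjoint_carrier[OF S]
  have gram: "(K * S) * mat_adjoint (K * S) = K * V * mat_adjoint K" if K: "K \<in> carrier_mat r p" for K
  proof -
    note K' = mat_adjoint_carrier[OF K]
    have "(K * S) * mat_adjoint (K * S) = ((K * S) * mat_adjoint S) * mat_adjoint K"
      unfolding mat_adjoint_mult[OF K S]
      by (rule assoc_mult_mat[symmetric, OF mult_carrier_mat[OF K S] S' K'])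
    then show ?thesis unfolding VS assoc_mult_mat[OF K S S'] .
  qed
  have ES: "E * S \<in> carrier_mat r p" and FS: "F * S \<in> carrier_mat r p" using E F S by auto
  obtain Q where Q: "unitary_mat p Q" and FSQ: "F * S = E * S * Q"
    using unitary_factor_of_equal_gram[OF ES FS] gram[OF E] gram[OF F] eq by auto
  note Qc = unitary_matD(1)[OF Q]
  obtain P d where P: "unitary_mat p P" and QP: "\<And>j. j < p \<Longrightarrow> Q *\<^sub>v col P j = d j \<cdot>\<^sub>v col P j"
    using normal_mat_unitary_diagonalization[OF Qc] unitary_matD[OF Q] by auto
  note Pc = unitary_matD(1)[OF P] and P' = mat_adjoint_carrier[OF unitary_matD(1)[OF P]]
  have "(S * P) * mat_adjoint (S * P) = S * (P * (mat_adjoint P * mat_adjoint S))"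
    unfolding mat_adjoint_mult[OF S Pc] by (rule assoc_mult_mat[OF S Pc mult_carrier_mat[OF P' S']])
  also have "P * (mat_adjoint P * mat_adjoint S) = mat_adjoint S"
    unfolding assoc_mult_mat[OF Pc P' S', symmetric] unitary_matD(3)[OF P] by (rule left_mult_one_mat[OF S'])
  finally have VT: "V = (S * P) * mat_adjoint (S * P)" by (simp add: VS)
  have "\<exists>c. cmod c = 1 \<and> F *\<^sub>v col (S * P) j = c \<cdot>\<^sub>v (E *\<^sub>v col (S * P) j)" if j: "j < p" for j
  proof (intro exI conjI)
    let ?y = "col P j"
    have y: "?y \<in> carrier_vec p" using Pc by auto
    have "complex_of_real ((cmod (d j))\<^sup>2) = (Q *\<^sub>v ?y) \<bullet>c (Q *\<^sub>v ?y)"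
      unfolding QP[OF j] cscalar_prod_self sqnorm_smult unitary_mat_sqnorm_col[OF P j] by simp
    also have "\<dots> = 1"
      unfolding unitary_mat_cscalar_prod[OF Q y y] using unitary_mat_sqnorm_col[OF P j] by (simp add: cscalar_prod_self)
    finally have "(cmod (d j))\<^sup>2 = 1" by (simp only: of_real_eq_1_iff)
    then show "cmod (d j) = 1" using norm_ge_zero[of "d j"] by (simp add: power2_eq_1_iff)
    have T: "col (S * P) j = S *\<^sub>v ?y" by (rule col_mult2[OF S Pc j])
    have Sy: "S *\<^sub>v ?y \<in> carrier_vec p" using S y by simp
    have "F *\<^sub>v col (S * P) j = (F * S) *\<^sub>v ?y"
      unfolding T by (rule assoc_mult_mat_vec[symmetric, OF F S y])
    also have "\<dots> = (E * S) *\<^sub>v (Q *\<^sub>v ?y)"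
      unfolding FSQ by (rule assoc_mult_mat_vec[OF ES Qc y])
    also have "\<dots> = d j \<cdot>\<^sub>v ((E * S) *\<^sub>v ?y)"
      unfolding QP[OF j] by (rule mult_mat_vec[OF ES y])
    also have "(E * S) *\<^sub>v ?y = E *\<^sub>v col (S * P) j"
      unfolding T by (rule assoc_mult_mat_vec[OF E S y])
    finally show "F *\<^sub>v col (S * P) j = d j \<cdot>\<^sub>v (E *\<^sub>v col (S * P) j)" .
  qed
  with VT show ?thesis using S Pc by (intro bexI[of _ "S * P"]) auto
qed

section \<open>Dissipation for Schur stable matrices\<close>

lemma pow_mat_smult:
  assumes "A \<in> carrier_mat n n"
  shows "(c \<cdot>\<^sub>m A) ^\<^sub>m k = c ^ k \<cdot>\<^sub>m (A ^\<^sub>m k :: complex mat)"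
proof (induction k)
  case 0
  then show ?case using assms by (intro eq_matI) auto
next
  case (Suc k)
  have "(c \<cdot>\<^sub>m A) ^\<^sub>m Suc k = (c ^ k \<cdot>\<^sub>m A ^\<^sub>m k) * (c \<cdot>\<^sub>m A)" using Suc by simp
  also have "\<dots> = c ^ k \<cdot>\<^sub>m (c \<cdot>\<^sub>m (A ^\<^sub>m k * A))"
    using mult_smult_assoc_mat[OF pow_carrier_mat[OF assms], of "c \<cdot>\<^sub>m A" n "c ^ k" k]
      mult_smult_distrib[OF pow_carrier_mat[OF assms] assms, of k c] assms by simp
  also have "\<dots> = c ^ Suc k \<cdot>\<^sub>m (A ^\<^sub>m Suc k)"
    using assms by (intro eq_matI) auto
  finally show ?case .
qed

text \<open>
Dividing \<open>A\<close> by a number \<open>r\<close> strictly between its spectral radius and 1 keeps the spectral radius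
below 1, and the powers of the scaled matrix are bounded.
\<close>
lemma schur_stable_power_bound:
  assumes A: "A \<in> carrier_mat n n" and n: "n > 0" and stable: "spectral_radius A < 1"
  shows "\<exists>c r. 0 \<le> c \<and> 0 < r \<and> r < 1 \<and> (\<forall>k. norm_bound (A ^\<^sub>m k) (c * r ^ k))"
proof -
  \<comment> \<open>The midpoint between the spectral radius and 1 leaves room for the decay.\<close>
  define \<rho> where "\<rho> = spectral_radius A"
  have \<rho>0: "\<rho> \<ge> 0" using spectral_radius_mem_max(1)[OF A n] by (auto simp: \<rho>_def)
  define r where "r = (\<rho> + 1) / 2"
  have r: "0 < r" "r < 1" "\<rho> < r" using \<rho>0 stable by (auto simp: r_def \<rho>_def)
  define A1 where "A1 = complex_of_real (1 / r) \<cdot>\<^sub>m A"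
  have A1: "A1 \<in> carrier_mat n n" using A by (simp add: A1_def)
  have "spectral_radius A1 < 1"
  proof -
    obtain \<mu> where \<mu>: "eigenvalue A1 \<mu>" and sr: "spectral_radius A1 = cmod \<mu>"
      using spectral_radius_mem_max(1)[OF A1 n] by (auto simp: spectrum_def)
    obtain v where v: "v \<in> carrier_vec n" "v \<noteq> 0\<^sub>v n" and A1v: "A1 *\<^sub>v v = \<mu> \<cdot>\<^sub>v v"
      using \<mu> A1 by (auto simp: eigenvalue_def eigenvector_def)
    have "A *\<^sub>v v = (complex_of_real r * \<mu>) \<cdot>\<^sub>v v"
    proof (rule eq_vecI)
      fix i assume i: "i < dim_vec ((complex_of_real r * \<mu>) \<cdot>\<^sub>v v)"
      have "(A1 *\<^sub>v v) $ i = complex_of_real (1 / r) * (A *\<^sub>v v) $ i"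
        using i v A by (simp add: A1_def scalar_prod_def sum_distrib_left sum_divide_distrib)
      then show "(A *\<^sub>v v) $ i = ((complex_of_real r * \<mu>) \<cdot>\<^sub>v v) $ i"
        using A1v i v r by (simp add: field_simps)
    qed (use A v in auto)
    then have "complex_of_real r * \<mu> \<in> spectrum A"
      using v A by (auto simp: spectrum_def eigenvalue_def eigenvector_def)
    then have "cmod (complex_of_real r * \<mu>) \<le> \<rho>"
      using spectral_radius_mem_max(2)[OF A n] by (auto simp: \<rho>_def)
    then have "r * cmod \<mu> \<le> \<rho>" using r by (simp add: norm_mult)
    then have "r * cmod \<mu> < r * 1" using r by linarith
    then show ?thesis unfolding sr by (rule mult_left_less_imp_less) (use r in simp)
  qed
  then obtain c where c: "\<And>k. norm_bound (A1 ^\<^sub>m k) c"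
    using spectral_radius_jnf_norm_bound_less_1_upper_triangular[OF A1] by blast
  have "norm_bound (A ^\<^sub>m k) (\<bar>c\<bar> * r ^ k)" for k
  proof (rule norm_boundI)
    fix i j assume "i < dim_row (A ^\<^sub>m k)" "j < dim_col (A ^\<^sub>m k)"
    then have ij: "i < n" "j < n" using A by (auto split: if_splits)
    have "norm ((A1 ^\<^sub>m k) $$ (i, j)) \<le> c"
      using c[of k] ij A1 unfolding norm_bound_def by simp
    then have "norm ((A1 ^\<^sub>m k) $$ (i, j)) \<le> \<bar>c\<bar>" by linarith
    moreover have "(A1 ^\<^sub>m k) $$ (i, j) = complex_of_real (1 / r) ^ k * (A ^\<^sub>m k) $$ (i, j)"
      unfolding A1_def pow_mat_smult[OF A] using ij A by simp
    ultimately show "norm ((A ^\<^sub>m k) $$ (i, j)) \<le> \<bar>c\<bar> * r ^ k"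
      using r by (simp add: norm_mult norm_power norm_divide power_divide field_simps)
  qed
  then show ?thesis using r by (intro exI[of _ "\<bar>c\<bar>"] exI[of _ r]) auto
qed

lemma sqnorm_mult_mat_vec_le:
  assumes M: "M \<in> carrier_mat a b" and v: "v \<in> carrier_vec b"
    and bound: "norm_bound M e" and e: "0 \<le> e"
  shows "sqnorm (M *\<^sub>v v) \<le> real a * real b * e\<^sup>2 * sqnorm v"
proof -
  have "(cmod ((M *\<^sub>v v) $ i))\<^sup>2 \<le> real b * e\<^sup>2 * sqnorm v" if i: "i < a" for i
  proof -
    have "cmod ((M *\<^sub>v v) $ i) = cmod (\<Sum>j<b. M $$ (i, j) * v $ j)"
      using M v i by (simp add: scalar_prod_def atLeast0LessThan)
    also have "\<dots> \<le> (\<Sum>j<b. cmod (M $$ (i, j) * v $ j))" by (rule norm_sum)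
    also have "\<dots> \<le> (\<Sum>j<b. e * cmod (v $ j))"
      using M i bound by (intro sum_mono) (auto simp: norm_mult norm_bound_def intro!: mult_right_mono)
    finally have "(cmod ((M *\<^sub>v v) $ i))\<^sup>2 \<le> (\<Sum>j<b. e * cmod (v $ j))\<^sup>2"
      by (intro power_mono) auto
    also have "\<dots> \<le> (\<Sum>j<b. (e * cmod (v $ j))\<^sup>2) * real b"
      using sum_squared_le_sum_of_squares[of "\<lambda>j. e * cmod (v $ j)" "{..<b}"] by simp
    also have "\<dots> = real b * e\<^sup>2 * sqnorm v"
      using v by (simp add: sqnorm_def power_mult_distrib sum_distrib_left sum_distrib_right ac_simps)
    finally show ?thesis .
  qed
  then have "(\<Sum>i<a. (cmod ((M *\<^sub>v v) $ i))\<^sup>2) \<le> (\<Sum>i<a. real b * e\<^sup>2 * sqnorm v)"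
    by (intro sum_mono) auto
  then show ?thesis using M by (simp add: sqnorm_def[of "M *\<^sub>v v"] mult.assoc)
qed

lemma bounded_mat_vec:
  assumes M: "M \<in> carrier_mat a b"
  shows "\<exists>K\<ge>0. \<forall>v \<in> carrier_vec b. sqnorm (M *\<^sub>v v) \<le> K * sqnorm v"
proof -
  obtain e where "norm_bound M e" using norm_bound_max by blast
  then have "norm_bound M \<bar>e\<bar>" by (fastforce simp: norm_bound_def)
  then have "\<forall>v \<in> carrier_vec b. sqnorm (M *\<^sub>v v) \<le> (real a * real b * \<bar>e\<bar>\<^sup>2) * sqnorm v"
    by (intro ballI sqnorm_mult_mat_vec_le[OF M]) auto
  then show ?thesis by (intro exI[of _ "real a * real b * \<bar>e\<bar>\<^sup>2"]) simp
qed

text \<open>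
This is Young's inequality in each coordinate; a small \<open>e\<close> lets the dissipation argument below
absorb the cross term.
\<close>
lemma sqnorm_add_le:
  assumes e: "e > 0" and a: "a \<in> carrier_vec p" and b: "b \<in> carrier_vec p"
  shows "sqnorm (a + b) \<le> (1 + e) * sqnorm a + (1 + 1 / e) * sqnorm b"
proof -
  have "(cmod (x + y))\<^sup>2 \<le> (1 + e) * (cmod x)\<^sup>2 + (1 + 1 / e) * (cmod y)\<^sup>2" for x y
  proof -
    have "(cmod (x + y))\<^sup>2 \<le> (cmod x + cmod y)\<^sup>2"
      by (intro power_mono norm_triangle_ineq) auto
    also have "0 \<le> (e * cmod x - cmod y)\<^sup>2 / e" using e by simp
    then have "2 * cmod x * cmod y \<le> e * (cmod x)\<^sup>2 + (cmod y)\<^sup>2 / e"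
      using e by (simp add: power2_eq_square field_simps)
    then have "(cmod x + cmod y)\<^sup>2 \<le> (1 + e) * (cmod x)\<^sup>2 + (1 + 1 / e) * (cmod y)\<^sup>2"
      by (simp add: power2_sum algebra_simps)
    finally show ?thesis .
  qed
  then have "(\<Sum>i<p. (cmod (a $ i + b $ i))\<^sup>2) \<le>
      (\<Sum>i<p. (1 + e) * (cmod (a $ i))\<^sup>2 + (1 + 1 / e) * (cmod (b $ i))\<^sup>2)"
    by (intro sum_mono) auto
  then show ?thesis using a b by (simp add: sqnorm_def sum.distrib sum_distrib_left)
qed

text \<open>
The storage function is four times \<open>q x = |x|\<^sup>2 + |A x|\<^sup>2 + \<dots> + |A\<^sup>N\<^sup>-\<^sup>1 x|\<^sup>2\<close>, where \<open>N\<close> is so large that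
\<open>|A\<^sup>N x|\<^sup>2 \<le> |x|\<^sup>2 / 2\<close>. Telescoping shows that \<open>q\<close> drops by at least \<open>|x|\<^sup>2 / 2\<close> along \<open>x \<mapsto> A x\<close>. As \<open>q\<close> is bounded by
a multiple of \<open>|x|\<^sup>2\<close>, Young's inequality with a small parameter loses only half of this drop to the
cross term with the input.
\<close>
lemma stable_dissipation:
  assumes A: "A \<in> carrier_mat n n" and n: "n > 0" and stable: "spectral_radius A < 1"
    and B: "B \<in> carrier_mat n m"
  shows "\<exists>q K. 0 \<le> K \<and> q (0\<^sub>v n) = 0 \<and> (\<forall>x \<in> carrier_vec n. 0 \<le> q x) \<and>
    (\<forall>x \<in> carrier_vec n. \<forall>c. cmod c = 1 \<longrightarrow> q (c \<cdot>\<^sub>v x) = q x) \<and>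
    (\<forall>x \<in> carrier_vec n. \<forall>w \<in> carrier_vec m.
       q (A *\<^sub>v x + B *\<^sub>v w) + sqnorm x \<le> q x + K * sqnorm (w :: complex vec))"
proof -
  obtain c r where c: "0 \<le> c" and r: "0 < r" "r < 1" and bound: "\<And>k. norm_bound (A ^\<^sub>m k) (c * r ^ k)"
    using schur_stable_power_bound[OF A n stable] by blast
  have "(\<lambda>k. real n * real n * (c * r ^ k)\<^sup>2) \<longlonglongrightarrow> real n * real n * (c * 0)\<^sup>2"
    using r by (intro tendsto_intros LIMSEQ_power_zero) auto
  then have "eventually (\<lambda>k. real n * real n * (c * r ^ k)\<^sup>2 < 1 / 2) sequentially"
    by (rule order_tendstoD(2)) simp
  then obtain N where N: "real n * real n * (c * r ^ N)\<^sup>2 < 1 / 2"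
    by (auto simp: eventually_sequentially)
  note Ak = pow_carrier_mat[OF A]
  have pow_le: "sqnorm ((A ^\<^sub>m k) *\<^sub>v x) \<le> real n * real n * (c * r ^ k)\<^sup>2 * sqnorm x" if "x \<in> carrier_vec n" for k x
    using sqnorm_mult_mat_vec_le[OF Ak that bound] c r by simp
  define q where "q x = (\<Sum>j<N. sqnorm ((A ^\<^sub>m j) *\<^sub>v x))" for x
  have q0: "q x \<ge> 0" for x by (auto simp: q_def intro!: sum_nonneg sqnorm_nonneg)
  define K1 where "K1 = real N * (real n * real n * c\<^sup>2)"
  have K1: "K1 \<ge> 0" by (simp add: K1_def)
  have q_le: "q x \<le> K1 * sqnorm x" if x: "x \<in> carrier_vec n" for x
  proof -
    have "sqnorm ((A ^\<^sub>m k) *\<^sub>v x) \<le> real n * real n * c\<^sup>2 * sqnorm x" for k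
    proof -
      have "(c * r ^ k)\<^sup>2 \<le> c\<^sup>2"
        using c r by (intro power_mono) (auto simp: mult_left_le power_le_one)
      then have "real n * real n * (c * r ^ k)\<^sup>2 * sqnorm x \<le> real n * real n * c\<^sup>2 * sqnorm x"
        by (intro mult_right_mono mult_left_mono sqnorm_nonneg) auto
      with pow_le[OF x, of k] show ?thesis by linarith
    qed
    then have "q x \<le> (\<Sum>j<N. real n * real n * c\<^sup>2 * sqnorm x)"
      unfolding q_def by (intro sum_mono) auto
    then show ?thesis by (simp add: K1_def mult.assoc)
  qed
  have q_step: "q (A *\<^sub>v x) + sqnorm x / 2 \<le> q x" if x: "x \<in> carrier_vec n" for x
  proof -
    have "q (A *\<^sub>v x) = (\<Sum>j<N. sqnorm ((A ^\<^sub>m Suc j) *\<^sub>v x))"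
      using assoc_mult_mat_vec[OF Ak A x] by (simp add: q_def)
    also have "\<dots> + sqnorm ((A ^\<^sub>m 0) *\<^sub>v x) = (\<Sum>j<Suc N. sqnorm ((A ^\<^sub>m j) *\<^sub>v x))"
      by (simp only: sum.lessThan_Suc_shift add.commute)
    finally have "q (A *\<^sub>v x) + sqnorm x = q x + sqnorm ((A ^\<^sub>m N) *\<^sub>v x)"
      using A x by (simp add: q_def)
    moreover have "sqnorm ((A ^\<^sub>m N) *\<^sub>v x) \<le> 1 / 2 * sqnorm x"
      using pow_le[OF x, of N] N mult_right_mono[of _ "1/2" "sqnorm x"] sqnorm_nonneg[of x]
      by (meson less_imp_le order_trans)
    ultimately show ?thesis by linarith
  qed
  \<comment> \<open>Since \<open>q x \<le> K1 |x|\<^sup>2\<close>, this makes the loss \<open>e * q (A x)\<close> at most half of the drop \<open>|x|\<^sup>2 / 2\<close>.\<close>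
  define e where "e = 1 / (4 * (K1 + 1))"
  have e: "e > 0" using K1 by (simp add: e_def)
  have q_add: "q (a + b) \<le> (1 + e) * q a + (1 + 1 / e) * q b"
    if a: "a \<in> carrier_vec n" and b: "b \<in> carrier_vec n" for a b
  proof -
    have "sqnorm ((A ^\<^sub>m j) *\<^sub>v (a + b)) \<le> (1 + e) * sqnorm ((A ^\<^sub>m j) *\<^sub>v a) + (1 + 1 / e) * sqnorm ((A ^\<^sub>m j) *\<^sub>v b)" for j
      unfolding mult_add_distrib_mat_vec[OF Ak a b]
      by (rule sqnorm_add_le[OF e mult_mat_vec_carrier[OF Ak a] mult_mat_vec_carrier[OF Ak b]])
    then show ?thesis
      unfolding q_def sum_distrib_left sum.distrib[symmetric] by (intro sum_mono) auto
  qed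
  obtain KB where KB: "KB \<ge> 0" "\<And>w. w \<in> carrier_vec m \<Longrightarrow> sqnorm (B *\<^sub>v w) \<le> KB * sqnorm w"
    using bounded_mat_vec[OF B] by blast
  define K where "K = (1 + 1 / e) * (K1 * KB)"
  have K: "K \<ge> 0" using e K1 KB by (simp add: K_def)
  have main: "q (A *\<^sub>v x + B *\<^sub>v w) + sqnorm x / 4 \<le> q x + K * sqnorm w"
    if x: "x \<in> carrier_vec n" and w: "w \<in> carrier_vec m" for x w
  proof -
    have Ax: "A *\<^sub>v x \<in> carrier_vec n" and Bw: "B *\<^sub>v w \<in> carrier_vec n" using A B x w by auto
    have "q (B *\<^sub>v w) \<le> K1 * (KB * sqnorm w)"
      using q_le[OF Bw] mult_left_mono[OF KB(2)[OF w] K1] by linarith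
    then have 1: "(1 + 1 / e) * q (B *\<^sub>v w) \<le> K * sqnorm w"
      unfolding K_def mult.assoc using e by (intro mult_left_mono) auto
    have "q (A *\<^sub>v x) \<le> q x" using q_step[OF x] sqnorm_nonneg[of x] by linarith
    then have "e * q (A *\<^sub>v x) \<le> e * (K1 * sqnorm x)"
      using q_le[OF x] e by (intro mult_left_mono) auto
    also have "\<dots> = (e * K1) * sqnorm x" by simp
    also have "\<dots> \<le> 1 / 4 * sqnorm x"
      using K1 by (intro mult_right_mono sqnorm_nonneg) (simp add: e_def field_simps)
    finally have 2: "(1 + e) * q (A *\<^sub>v x) \<le> q x - sqnorm x / 4"
      using q_step[OF x] by (simp add: distrib_right)
    show ?thesis using q_add[OF Ax Bw] 1 2 by linarith
  qed
  have q_rot: "q (c \<cdot>\<^sub>v x) = q x" if "x \<in> carrier_vec n" "cmod c = 1" for c x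
    unfolding q_def using that by (simp add: mult_mat_vec[OF Ak] sqnorm_smult)
  have q_0: "q (0\<^sub>v n) = 0"
    using q_le[of "0\<^sub>v n"] q0[of "0\<^sub>v n"] by simp
  show ?thesis
  proof (intro exI[of _ "\<lambda>x. 4 * q x"] exI[of _ "4 * K"] conjI ballI allI impI)
    fix x w :: "complex vec" assume "x \<in> carrier_vec n" "w \<in> carrier_vec m"
    from main[OF this] show "4 * q (A *\<^sub>v x + B *\<^sub>v w) + sqnorm x \<le> 4 * q x + 4 * K * sqnorm w"
      by linarith
  qed (use K q0 q_rot q_0 in auto)
qed

section \<open>Convergence of averages and subsequences\<close>

lemma tendsto_zero_dominated:
  fixes f :: "'a \<Rightarrow> real" and g :: "'a \<Rightarrow> 'b :: real_normed_vector"
  assumes "\<forall>\<^sub>F x in F. norm (g x) \<le> f x" "(f \<longlongrightarrow> 0) F"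
  shows "(g \<longlongrightarrow> 0) F"
  by (rule tendsto_0_le[OF assms(2), of g 1]) (use assms(1) in \<open>auto elim!: eventually_mono\<close>)

lemma cesaro_mean:
  fixes f :: "nat \<Rightarrow> real"
  assumes f: "f \<longlonglongrightarrow> L"
  shows "(\<lambda>N. (1 / real N) * (\<Sum>k<N. f k)) \<longlonglongrightarrow> L"
proof (rule LIMSEQ_I)
  fix e :: real assume e: "0 < e"
  then obtain M where M: "\<And>k. k \<ge> M \<Longrightarrow> \<bar>f k - L\<bar> < e / 2"
    using LIMSEQ_D[OF f, of "e / 2"] by auto
  define c where "c = (\<Sum>k<M. \<bar>f k - L\<bar>)"
  have c: "c \<ge> 0" by (simp add: c_def sum_nonneg)
  obtain N0 :: nat where N0: "2 * c / e < real N0" using reals_Archimedean2 by blast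
  have "norm ((1 / real N) * (\<Sum>k<N. f k) - L) < e" if N: "N \<ge> max (Suc M) N0" for N
  proof -
    have Npos: "real N > 0" using N by simp
    have "2 * c / e < real N" using N0 N by (simp add: less_le_trans)
    then have c_small: "c < real N * (e / 2)" using e by (simp add: field_simps)
    have split: "{..<N} = {..<M} \<union> {M..<N}" using N by auto
    have "\<bar>\<Sum>k<N. f k - L\<bar> \<le> (\<Sum>k<N. \<bar>f k - L\<bar>)" by (rule sum_abs)
    also have "\<dots> = c + (\<Sum>k=M..<N. \<bar>f k - L\<bar>)"
      unfolding c_def split by (rule sum.union_disjoint) auto
    also have "\<dots> \<le> c + (\<Sum>k=M..<N. e / 2)"
      using M by (intro add_left_mono sum_mono less_imp_le) auto
    also have "\<dots> \<le> c + real N * (e / 2)" using e by (simp add: mult_right_mono)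
    also have "\<dots> < real N * e" using c_small by simp
    finally have "\<bar>\<Sum>k<N. f k - L\<bar> < real N * e" .
    moreover have "(1 / real N) * (\<Sum>k<N. f k) - L = (\<Sum>k<N. f k - L) / real N"
      using Npos by (simp add: sum_subtractf field_simps)
    ultimately show ?thesis using Npos by (simp add: field_simps)
  qed
  then show "\<exists>no. \<forall>N\<ge>no. norm ((1 / real N) * (\<Sum>k<N. f k) - L) < e" by blast
qed

lemma bounded_complex_convergent_subsequence:
  fixes f :: "nat \<Rightarrow> complex"
  assumes "\<And>k. cmod (f k) \<le> K"
  shows "\<exists>l r. strict_mono (r :: nat \<Rightarrow> nat) \<and> (\<lambda>k. f (r k)) \<longlonglongrightarrow> l"
proof -
  have "bounded (range (\<lambda>k. (Re (f k), Im (f k))))"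
  proof (rule boundedI)
    fix p assume "p \<in> range (\<lambda>k. (Re (f k), Im (f k)))"
    then obtain k where "p = (Re (f k), Im (f k))" by blast
    then have "norm p = cmod (f k)" by (simp add: norm_Pair cmod_def)
    then show "norm p \<le> K" using assms by simp
  qed
  then obtain l r where r: "strict_mono (r :: nat \<Rightarrow> nat)"
    and l: "((\<lambda>k. (Re (f k), Im (f k))) \<circ> r) \<longlonglongrightarrow> l"
    using bounded_imp_convergent_subsequence by blast
  have "(\<lambda>k. Complex (Re (f (r k))) (Im (f (r k)))) \<longlonglongrightarrow> Complex (fst l) (snd l)"
    using tendsto_fst[OF l] tendsto_snd[OF l] by (intro tendsto_Complex) (simp_all add: o_def)
  then show ?thesis using r by auto
qed

lemma simultaneous_convergent_subsequence:
  fixes f :: "nat \<Rightarrow> 'i \<Rightarrow> complex"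
  assumes "finite I" "\<forall>i \<in> I. \<forall>k. cmod (f k i) \<le> K"
  shows "\<exists>r L. strict_mono (r :: nat \<Rightarrow> nat) \<and> (\<forall>i \<in> I. (\<lambda>k. f (r k) i) \<longlonglongrightarrow> L i)"
  using assms
proof (induction I)
  case empty
  then show ?case using strict_mono_id by auto
next
  case (insert a I)
  then obtain r L where r: "strict_mono (r :: nat \<Rightarrow> nat)" and L: "\<forall>i \<in> I. (\<lambda>k. f (r k) i) \<longlonglongrightarrow> L i"
    by auto
  have "\<And>k. cmod (f (r k) a) \<le> K" using insert.prems by simp
  then obtain la s where s: "strict_mono (s :: nat \<Rightarrow> nat)" and la: "(\<lambda>k. f (r (s k)) a) \<longlonglongrightarrow> la"
    using bounded_complex_convergent_subsequence[of "\<lambda>k. f (r k) a"] by blast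
  have "(\<lambda>k. f (r (s k)) i) \<longlonglongrightarrow> (if i = a then la else L i)" if "i \<in> insert a I" for i
    using that la L LIMSEQ_subseq_LIMSEQ[OF _ s, of "\<lambda>k. f (r k) i"] by (auto simp: o_def)
  then show ?case
    using strict_mono_o[OF r s] unfolding o_def
    by (intro exI[of _ "\<lambda>k. r (s k)"] exI[of _ "\<lambda>i. if i = a then la else L i"]) auto
qed

section \<open>Block rows, Gram matrices and their limits\<close>

lemma append_cols_carrier [simp]:
  "A \<in> carrier_mat r a \<Longrightarrow> B \<in> carrier_mat r b \<Longrightarrow> A @\<^sub>c B \<in> carrier_mat r (a + b)"
  by (auto simp: append_cols_def intro!: carrier_matI)

lemma append_cols_mult_vec:
  assumes A: "A \<in> carrier_mat r a" and B: "B \<in> carrier_mat r b"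
    and x: "x \<in> carrier_vec a" and w: "w \<in> carrier_vec b"
  shows "(A @\<^sub>c B) *\<^sub>v (x @\<^sub>v w) = A *\<^sub>v x + B *\<^sub>v w"
proof -
  have d: "dim_col A = a" "dim_col B = b" using A B by auto
  show ?thesis
    unfolding append_cols_def d
      four_block_mat_mult_vec[OF A B zero_carrier_mat[of 0 a] zero_carrier_mat[of 0 b] x w]
    by (rule eq_vecI) (use A B in auto)
qed

lemma mat_adjoint_append_cols:
  assumes A: "A \<in> carrier_mat r a" and B: "B \<in> carrier_mat r b"
  shows "mat_adjoint (A @\<^sub>c B) = mat_adjoint A @\<^sub>r mat_adjoint B"
  by (rule eq_matI) (use A B in \<open>auto simp: append_cols_def append_rows_def\<close>)

lemma mat_adjoint_one: "mat_adjoint (1\<^sub>m n) = (1\<^sub>m n :: complex mat)"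
  by (rule eq_matI) auto

lemma mat_adjoint_zero: "mat_adjoint (0\<^sub>m n m) = (0\<^sub>m m n :: complex mat)"
  by (rule eq_matI) auto

lemma sqnorm_append: "sqnorm (x @\<^sub>v w) = sqnorm x + sqnorm w"
proof -
  have "(\<Sum>i<a + b. f i) = (\<Sum>i<a. f i) + (\<Sum>i<b. f (a + i))" for a b and f :: "nat \<Rightarrow> real"
    by (induction b) simp_all
  then show ?thesis by (simp add: sqnorm_def)
qed

lemma vec_split:
  assumes "v \<in> carrier_vec (n + m)"
  obtains x w where "x \<in> carrier_vec n" "w \<in> carrier_vec m" "v = x @\<^sub>v w"
  using vec_first_last_append[OF assms] vec_first_carrier[of v n] vec_last_carrier[of v m] by metis

lemma sandwich_gram_index:
  assumes K: "K \<in> carrier_mat r p" and T: "T \<in> carrier_mat p q" and ab: "a < r" "b < r"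
  shows "(K * (T * mat_adjoint T) * mat_adjoint K) $$ (a, b) =
    (\<Sum>j<q. (K *\<^sub>v col T j) $ a * cnj ((K *\<^sub>v col T j) $ b))"
proof -
  note K' = mat_adjoint_carrier[OF K] and T' = mat_adjoint_carrier[OF T]
  have KT: "K * T \<in> carrier_mat r q" using K T by simp
  have "K * (T * mat_adjoint T) * mat_adjoint K = (K * T) * mat_adjoint (K * T)"
    unfolding mat_adjoint_mult[OF K T] assoc_mult_mat[OF K T T', symmetric]
    by (rule assoc_mult_mat[OF KT T' K'])
  then show ?thesis
    unfolding mult_mat_adjoint_index[OF KT KT ab, symmetric]
    using ab K T mult_mat_adjoint_index[OF KT KT ab] by simp
qed

lemma trace_gram_sandwich:
  assumes K: "K \<in> carrier_mat r p" and T: "T \<in> carrier_mat p q"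
  shows "Re (mat_trace (K * (T * mat_adjoint T) * mat_adjoint K)) = (\<Sum>j<q. sqnorm (K *\<^sub>v col T j))"
proof -
  have "mat_trace (K * (T * mat_adjoint T) * mat_adjoint K) =
    (\<Sum>i<r. \<Sum>j<q. (K *\<^sub>v col T j) $ i * cnj ((K *\<^sub>v col T j) $ i))"
    unfolding mat_trace_def using K sandwich_gram_index[OF K T] by (auto intro!: sum.cong)
  also have "\<dots> = (\<Sum>j<q. \<Sum>i<r. (K *\<^sub>v col T j) $ i * cnj ((K *\<^sub>v col T j) $ i))"
    by (rule sum.swap)
  also have "\<dots> = complex_of_real (\<Sum>j<q. sqnorm (K *\<^sub>v col T j))"
    using K by (auto simp: sqnorm_def complex_norm_square simp del: of_real_power intro!: sum.cong)
  finally show ?thesis by simp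
qed

text \<open>
Bounding entries by the trace is what makes the second moments compact.
\<close>
lemma gram_entry_bound:
  assumes T: "T \<in> carrier_mat p q" and ab: "a < p" "b < p"
  shows "cmod ((T * mat_adjoint T) $$ (a, b)) \<le> (\<Sum>j<q. sqnorm (col T j))"
proof -
  have "cmod ((T * mat_adjoint T) $$ (a, b)) \<le> (\<Sum>j<q. cmod (T $$ (a, j) * cnj (T $$ (b, j))))"
    unfolding mult_mat_adjoint_index[OF T T ab] by (rule norm_sum)
  also have "\<dots> \<le> (\<Sum>j<q. sqnorm (col T j))"
  proof (rule sum_mono)
    fix j assume j: "j \<in> {..<q}"
    have "(cmod (T $$ (i, j)))\<^sup>2 \<le> sqnorm (col T j)" if "i < p" for i
      using cmod_sq_le_sqnorm[of i "col T j"] that T j by simp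
    then have "cmod (T $$ (i, j)) \<le> sqrt (sqnorm (col T j))" if "i < p" for i
      using that by (simp add: real_le_rsqrt)
    then have "cmod (T $$ (a, j)) * cmod (T $$ (b, j)) \<le> sqrt (sqnorm (col T j)) * sqrt (sqnorm (col T j))"
      using ab by (intro mult_mono) (auto simp: sqnorm_nonneg)
    then show "cmod (T $$ (a, j) * cnj (T $$ (b, j))) \<le> sqnorm (col T j)"
      by (simp add: norm_mult sqnorm_nonneg)
  qed
  finally show ?thesis .
qed

lemma pos_semidef_gram:
  assumes T: "T \<in> carrier_mat p q"
  shows "pos_semidef (T * mat_adjoint T)"
proof -
  note T' = mat_adjoint_carrier[OF T]
  have herm: "mat_adjoint (T * mat_adjoint T) = T * mat_adjoint T"
    unfolding mat_adjoint_mult[OF T T'] by simp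
  have "0 \<le> Re ((T * mat_adjoint T *\<^sub>v v) \<bullet>c v)" if v: "v \<in> carrier_vec p" for v
  proof -
    have T'v: "mat_adjoint T *\<^sub>v v \<in> carrier_vec q" using T' v by simp
    show ?thesis
      unfolding assoc_mult_mat_vec[OF T T' v] cscalar_prod_mult_mat_vec[OF T T'v v] Re_cscalar_prod_self
      by (rule sqnorm_nonneg)
  qed
  then show ?thesis using T herm by (simp add: pos_semidef_def hermitian_mat_def)
qed

lemma sandwich_tendsto:
  fixes K :: "complex mat"
  assumes K: "K \<in> carrier_mat r p" and V: "\<And>k. V k \<in> carrier_mat p p" and W: "W \<in> carrier_mat p p"
    and lim: "\<And>a b. a < p \<Longrightarrow> b < p \<Longrightarrow> (\<lambda>k. V k $$ (a, b)) \<longlonglongrightarrow> W $$ (a, b)"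
    and ab: "a < r" "b < r"
  shows "(\<lambda>k. (K * V k * mat_adjoint K) $$ (a, b)) \<longlonglongrightarrow> (K * W * mat_adjoint K) $$ (a, b)"
proof -
  have expand: "(K * M * mat_adjoint K) $$ (a, b) =
    (\<Sum>c<p. (\<Sum>d<p. K $$ (a, d) * M $$ (d, c)) * cnj (K $$ (b, c)))" if M: "M \<in> carrier_mat p p" for M
    using ab K M mult_mat_adjoint_index[OF mult_carrier_mat[OF K M] K ab]
    by (auto simp: scalar_prod_def atLeast0LessThan intro!: sum.cong)
  show ?thesis unfolding expand[OF V] expand[OF W] by (intro tendsto_intros lim) auto
qed

lemma trace_sandwich_tendsto:
  fixes K :: "complex mat"
  assumes K: "K \<in> carrier_mat r p" and V: "\<And>k. V k \<in> carrier_mat p p" and W: "W \<in> carrier_mat p p"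
    and lim: "\<And>a b. a < p \<Longrightarrow> b < p \<Longrightarrow> (\<lambda>k. V k $$ (a, b)) \<longlonglongrightarrow> W $$ (a, b)"
  shows "(\<lambda>k. Re (mat_trace (K * V k * mat_adjoint K))) \<longlonglongrightarrow> Re (mat_trace (K * W * mat_adjoint K))"
proof -
  have "(\<lambda>k. Re (\<Sum>i<r. (K * V k * mat_adjoint K) $$ (i, i))) \<longlonglongrightarrow> Re (\<Sum>i<r. (K * W * mat_adjoint K) $$ (i, i))"
    by (intro tendsto_Re tendsto_sum sandwich_tendsto[OF K V W lim]) auto
  then show ?thesis using K by (simp add: mat_trace_def)
qed

lemma pos_semidef_limit:
  assumes V: "\<And>k. V k \<in> carrier_mat p p" and W: "W \<in> carrier_mat p p"
    and lim: "\<And>a b. a < p \<Longrightarrow> b < p \<Longrightarrow> (\<lambda>k. V k $$ (a, b)) \<longlonglongrightarrow> W $$ (a, b)"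
    and psd: "\<And>k. pos_semidef (V k)"
  shows "pos_semidef W"
proof -
  have "mat_adjoint W = W"
  proof (rule eq_matI)
    fix a b assume "a < dim_row W" "b < dim_col W"
    then have ab: "a < p" "b < p" using W by auto
    have "mat_adjoint (V k) = V k" for k using psd by (simp add: pos_semidef_def hermitian_mat_def)
    then have "cnj (V k $$ (b, a)) = V k $$ (a, b)" for k
      using ab V[of k] mat_adjoint_index[of a "V k" b] by simp
    then have "(\<lambda>k. V k $$ (a, b)) \<longlonglongrightarrow> cnj (W $$ (b, a))"
      using tendsto_cnj[OF lim[OF ab(2) ab(1)]] by simp
    then have "cnj (W $$ (b, a)) = W $$ (a, b)" using LIMSEQ_unique lim[OF ab] by blast
    then show "mat_adjoint W $$ (a, b) = W $$ (a, b)" using ab W by simp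
  qed (use W in auto)
  moreover have "0 \<le> Re ((W *\<^sub>v v) \<bullet>c v)" if v: "v \<in> carrier_vec p" for v
  proof (rule LIMSEQ_le_const)
    have expand: "(M *\<^sub>v v) \<bullet>c v = (\<Sum>i<p. (\<Sum>j<p. M $$ (i, j) * v $ j) * cnj (v $ i))"
      if "M \<in> carrier_mat p p" for M
      using that v by (simp add: scalar_prod_def atLeast0LessThan)
    show "(\<lambda>k. Re ((V k *\<^sub>v v) \<bullet>c v)) \<longlonglongrightarrow> Re ((W *\<^sub>v v) \<bullet>c v)"
      unfolding expand[OF V] expand[OF W] by (intro tendsto_intros lim) auto
    have "v \<in> carrier_vec (dim_row (V k))" for k using V[of k] v by simp
    then show "\<exists>N. \<forall>k\<ge>N. 0 \<le> Re ((V k *\<^sub>v v) \<bullet>c v)" using psd unfolding pos_semidef_def by blast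
  qed
  ultimately show ?thesis using W by (simp add: pos_semidef_def hermitian_mat_def)
qed

section \<open>The semidefinite program and the power gain of a stable system\<close>

lemma avg_power_sqnorm: "avg_power h N = (1 / real N) * (\<Sum>k<N. sqnorm (h k))"
  by (simp add: avg_power_def Re_cscalar_prod_self)

locale stable_system =
  fixes n m l :: nat and A B C D :: "complex mat"
  assumes n: "n > 0"
    and A: "A \<in> carrier_mat n n" and B: "B \<in> carrier_mat n m"
    and C: "C \<in> carrier_mat l n" and D: "D \<in> carrier_mat l m"
    and stable: "spectral_radius A < 1"
begin

abbreviation state_block :: "complex mat" where "state_block \<equiv> 1\<^sub>m n @\<^sub>c 0\<^sub>m n m"
abbreviation input_block :: "complex mat" where "input_block \<equiv> 0\<^sub>m m n @\<^sub>c 1\<^sub>m m"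

lemma carriers:
  "state_block \<in> carrier_mat n (n + m)" "input_block \<in> carrier_mat m (n + m)"
  "A @\<^sub>c B \<in> carrier_mat n (n + m)" "C @\<^sub>c D \<in> carrier_mat l (n + m)"
  using A B C D by auto

lemma block_mult_vec:
  assumes "x \<in> carrier_vec n" "w \<in> carrier_vec m"
  shows "state_block *\<^sub>v (x @\<^sub>v w) = x" "input_block *\<^sub>v (x @\<^sub>v w) = w"
    "(A @\<^sub>c B) *\<^sub>v (x @\<^sub>v w) = A *\<^sub>v x + B *\<^sub>v w" "(C @\<^sub>c D) *\<^sub>v (x @\<^sub>v w) = C *\<^sub>v x + D *\<^sub>v w"
  using append_cols_mult_vec[OF A B assms] append_cols_mult_vec[OF C D assms]
    append_cols_mult_vec[OF one_carrier_mat zero_carrier_mat assms]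
    append_cols_mult_vec[OF zero_carrier_mat one_carrier_mat assms] assms
  by auto

text \<open>
In the constraint of the program the right-hand factors are adjoints of the left-hand ones, so both
sides are congruence transforms of \<open>V\<close>.
\<close>
lemma sdp_feasible_iff:
  "sdp_feasible n m A B V \<longleftrightarrow> V \<in> carrier_mat (n + m) (n + m) \<and> pos_semidef V \<and>
     state_block * V * mat_adjoint state_block = (A @\<^sub>c B) * V * mat_adjoint (A @\<^sub>c B) \<and>
     Re (mat_trace (input_block * V * mat_adjoint input_block)) \<le> 1"
  unfolding sdp_feasible_def mat_adjoint_append_cols[OF A B]
    mat_adjoint_append_cols[OF one_carrier_mat zero_carrier_mat] mat_adjoint_one mat_adjoint_zero
  by (auto simp: pos_semidef_def)

text \<open>
The two consequences of dissipation that are used: a harmonic solution leaves the storage function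
unchanged, and a trajectory from the zero state starts with nothing stored.
\<close>
lemma state_gain:
  obtains K where "0 \<le> K"
    and "\<And>x w c. x \<in> carrier_vec n \<Longrightarrow> w \<in> carrier_vec m \<Longrightarrow> cmod c = 1 \<Longrightarrow>
      A *\<^sub>v x + B *\<^sub>v w = c \<cdot>\<^sub>v x \<Longrightarrow> sqnorm x \<le> K * sqnorm w"
    and "\<And>x w N. (\<forall>k. x k \<in> carrier_vec n) \<Longrightarrow> (\<forall>k. w k \<in> carrier_vec m) \<Longrightarrow> x 0 = 0\<^sub>v n \<Longrightarrow>
      (\<forall>k. x (Suc k) = A *\<^sub>v x k + B *\<^sub>v w k) \<Longrightarrow> (\<Sum>k<N. sqnorm (x k)) \<le> K * (\<Sum>k<N. sqnorm (w k))"
proof -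
  obtain q K where K: "0 \<le> K" and q0: "q (0\<^sub>v n) = 0" and q: "\<And>x. x \<in> carrier_vec n \<Longrightarrow> 0 \<le> q x"
    and rot: "\<And>x c. x \<in> carrier_vec n \<Longrightarrow> cmod c = 1 \<Longrightarrow> q (c \<cdot>\<^sub>v x) = q x"
    and diss: "\<And>x w. x \<in> carrier_vec n \<Longrightarrow> w \<in> carrier_vec m \<Longrightarrow>
       q (A *\<^sub>v x + B *\<^sub>v w) + sqnorm x \<le> q x + K * sqnorm w"
    using stable_dissipation[OF A n stable B] by metis
  show thesis
  proof (rule that[OF K])
    fix x w c assume "x \<in> carrier_vec n" "w \<in> carrier_vec m" "cmod c = 1" "A *\<^sub>v x + B *\<^sub>v w = c \<cdot>\<^sub>v x"
    then show "sqnorm x \<le> K * sqnorm w" using diss[of x w] rot[of x c] by simp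
  next
    fix x w :: "nat \<Rightarrow> complex vec" and N
    assume x: "\<forall>k. x k \<in> carrier_vec n" and w: "\<forall>k. w k \<in> carrier_vec m" and x0: "x 0 = 0\<^sub>v n"
      and step: "\<forall>k. x (Suc k) = A *\<^sub>v x k + B *\<^sub>v w k"
    have "q (x N) + (\<Sum>k<N. sqnorm (x k)) \<le> K * (\<Sum>k<N. sqnorm (w k))"
    proof (induction N)
      case 0
      then show ?case using x0 q0 by simp
    next
      case (Suc N)
      have "q (x (Suc N)) + sqnorm (x N) \<le> q (x N) + K * sqnorm (w N)"
        using diss[of "x N" "w N"] x w step by simp
      with Suc show ?case by (simp add: distrib_left)
    qed
    then show "(\<Sum>k<N. sqnorm (x k)) \<le> K * (\<Sum>k<N. sqnorm (w k))"
      using q[of "x N"] x by simp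
  qed
qed

text \<open>
An asymptotically feasible bounded sequence suffices: the constraints and the objective are
continuous in the entries, so they pass to the limit of an entrywise convergent subsequence. Both the
attainment of the maximum and the averaged second moments of a trajectory are instances.
\<close>
lemma sdp_values_closed:
  assumes V: "\<And>k. V k \<in> carrier_mat (n + m) (n + m)" and psd: "\<And>k. pos_semidef (V k)"
    and bound: "\<And>k a b. a < n + m \<Longrightarrow> b < n + m \<Longrightarrow> cmod (V k $$ (a, b)) \<le> K"
    and residual: "\<And>a b. a < n \<Longrightarrow> b < n \<Longrightarrow>
      (\<lambda>k. (state_block * V k * mat_adjoint state_block) $$ (a, b) - ((A @\<^sub>c B) * V k * mat_adjoint (A @\<^sub>c B)) $$ (a, b)) \<longlonglongrightarrow> 0"
    and power: "\<And>k. Re (mat_trace (input_block * V k * mat_adjoint input_block)) \<le> t k" and t: "t \<longlonglongrightarrow> \<tau>" "\<tau> \<le> 1"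
    and objective: "(\<lambda>k. sdp_objective C D (V k)) \<longlonglongrightarrow> s"
  shows "s \<in> sdp_values n m A B C D"
proof -
  obtain r L where r: "strict_mono (r :: nat \<Rightarrow> nat)"
    and L: "\<forall>i \<in> {..<n+m} \<times> {..<n+m}. (\<lambda>k. V (r k) $$ i) \<longlonglongrightarrow> L i"
    using simultaneous_convergent_subsequence[of "{..<n+m} \<times> {..<n+m}" "\<lambda>k i. V k $$ i" K] bound by auto
  define W where "W = mat (n + m) (n + m) L"
  have W: "W \<in> carrier_mat (n + m) (n + m)" by (simp add: W_def)
  have lim: "(\<lambda>k. V (r k) $$ (a, b)) \<longlonglongrightarrow> W $$ (a, b)" if "a < n + m" "b < n + m" for a b
    using L that by (auto simp: W_def)
  note subseq = LIMSEQ_subseq_LIMSEQ[OF _ r, unfolded o_def]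
  have "pos_semidef W" by (rule pos_semidef_limit[OF V W lim psd])
  moreover have "state_block * W * mat_adjoint state_block = (A @\<^sub>c B) * W * mat_adjoint (A @\<^sub>c B)"
  proof (rule eq_matI)
    fix a b assume "a < dim_row ((A @\<^sub>c B) * W * mat_adjoint (A @\<^sub>c B))" "b < dim_col ((A @\<^sub>c B) * W * mat_adjoint (A @\<^sub>c B))"
    then have ab: "a < n" "b < n" using carriers(3) by auto
    have "(\<lambda>k. (state_block * V (r k) * mat_adjoint state_block) $$ (a, b) - ((A @\<^sub>c B) * V (r k) * mat_adjoint (A @\<^sub>c B)) $$ (a, b))
        \<longlonglongrightarrow> (state_block * W * mat_adjoint state_block) $$ (a, b) - ((A @\<^sub>c B) * W * mat_adjoint (A @\<^sub>c B)) $$ (a, b)"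
      by (intro tendsto_diff sandwich_tendsto[OF carriers(1) V W lim ab] sandwich_tendsto[OF carriers(3) V W lim ab])
    from LIMSEQ_unique[OF this subseq[OF residual[OF ab]]]
    show "(state_block * W * mat_adjoint state_block) $$ (a, b) = ((A @\<^sub>c B) * W * mat_adjoint (A @\<^sub>c B)) $$ (a, b)" by simp
  qed (use carrier_matD[OF carriers(1)] carrier_matD[OF carriers(3)] in auto)
  moreover have "Re (mat_trace (input_block * W * mat_adjoint input_block)) \<le> \<tau>"
  proof (rule LIMSEQ_le)
    show "(\<lambda>k. Re (mat_trace (input_block * V (r k) * mat_adjoint input_block))) \<longlonglongrightarrow> Re (mat_trace (input_block * W * mat_adjoint input_block))"
      by (rule trace_sandwich_tendsto[OF carriers(2) V W lim])
    show "(\<lambda>k. t (r k)) \<longlonglongrightarrow> \<tau>" by (rule subseq[OF t(1)])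
  qed (use power in auto)
  moreover have "sdp_objective C D W = s"
  proof (rule LIMSEQ_unique)
    show "(\<lambda>k. sdp_objective C D (V (r k))) \<longlonglongrightarrow> sdp_objective C D W"
      unfolding sdp_objective_def by (rule trace_sandwich_tendsto[OF carriers(4) V W lim])
    show "(\<lambda>k. sdp_objective C D (V (r k))) \<longlonglongrightarrow> s" by (rule subseq[OF objective])
  qed
  ultimately have "sdp_feasible n m A B W" "sdp_objective C D W = s"
    unfolding sdp_feasible_iff using W t(2) by auto
  then show ?thesis unfolding sdp_values_def by blast
qed

text \<open>
Each column of the factor is the state and input amplitude of a harmonic solution of the system, and
the power and the objective of \<open>V\<close> are the sums of the contributions of these harmonics.
\<close>
lemma feasible_decomposition:
  assumes "sdp_feasible n m A B V"
  obtains T where "T \<in> carrier_mat (n + m) (n + m)" "V = T * mat_adjoint T"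
    and "\<And>j. j < n + m \<Longrightarrow> \<exists>x w c. x \<in> carrier_vec n \<and> w \<in> carrier_vec m \<and> cmod c = 1 \<and>
      col T j = x @\<^sub>v w \<and> A *\<^sub>v x + B *\<^sub>v w = c \<cdot>\<^sub>v x"
    and "(\<Sum>j<n + m. sqnorm (input_block *\<^sub>v col T j)) \<le> 1"
    and "sdp_objective C D V = (\<Sum>j<n + m. sqnorm ((C @\<^sub>c D) *\<^sub>v col T j))"
proof -
  note feas = assms[unfolded sdp_feasible_iff]
  obtain T where T: "T \<in> carrier_mat (n + m) (n + m)" and VT: "V = T * mat_adjoint T"
    and col: "\<And>j. j < n + m \<Longrightarrow> \<exists>c. cmod c = 1 \<and> (A @\<^sub>c B) *\<^sub>v col T j = c \<cdot>\<^sub>v (state_block *\<^sub>v col T j)"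
    using rank_one_decomposition[OF carriers(1) carriers(3), of V] feas by blast
  show thesis
  proof (rule that[OF T VT])
    fix j assume j: "j < n + m"
    have "col T j \<in> carrier_vec (n + m)" using T by (intro carrier_vecI) simp
    then obtain x w where "x \<in> carrier_vec n" "w \<in> carrier_vec m" "col T j = x @\<^sub>v w"
      by (rule vec_split)
    moreover from this col[OF j] obtain c where "cmod c = 1" "A *\<^sub>v x + B *\<^sub>v w = c \<cdot>\<^sub>v x"
      using block_mult_vec[of x w] by auto
    ultimately show "\<exists>x w c. x \<in> carrier_vec n \<and> w \<in> carrier_vec m \<and> cmod c = 1 \<and>
      col T j = x @\<^sub>v w \<and> A *\<^sub>v x + B *\<^sub>v w = c \<cdot>\<^sub>v x" by blast
  next
    show "(\<Sum>j<n + m. sqnorm (input_block *\<^sub>v col T j)) \<le> 1"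
      using feas unfolding VT trace_gram_sandwich[OF carriers(2) T] by simp
    show "sdp_objective C D V = (\<Sum>j<n + m. sqnorm ((C @\<^sub>c D) *\<^sub>v col T j))"
      unfolding VT sdp_objective_def by (rule trace_gram_sandwich[OF carriers(4) T])
  qed
qed

text \<open>
A harmonic solution has state power at most a multiple of its input power, so the bound on the input
power bounds the trace of a feasible point, and with it all entries and the objective.
\<close>
lemma sdp_bounded:
  obtains K M where "\<And>V a b. sdp_feasible n m A B V \<Longrightarrow> a < n + m \<Longrightarrow> b < n + m \<Longrightarrow> cmod (V $$ (a, b)) \<le> K"
    and "\<And>V. sdp_feasible n m A B V \<Longrightarrow> sdp_objective C D V \<le> M"
proof -
  obtain K where K: "0 \<le> K"
    and gain: "\<And>x w c. x \<in> carrier_vec n \<Longrightarrow> w \<in> carrier_vec m \<Longrightarrow> cmod c = 1 \<Longrightarrow>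
      A *\<^sub>v x + B *\<^sub>v w = c \<cdot>\<^sub>v x \<Longrightarrow> sqnorm x \<le> K * sqnorm w"
    using state_gain by metis
  obtain M where M: "0 \<le> M" "\<And>v. v \<in> carrier_vec (n + m) \<Longrightarrow> sqnorm ((C @\<^sub>c D) *\<^sub>v v) \<le> M * sqnorm v"
    using bounded_mat_vec[OF carriers(4)] by blast
  have main: "(\<forall>a<n+m. \<forall>b<n+m. cmod (V $$ (a, b)) \<le> K + 1) \<and> sdp_objective C D V \<le> M * (K + 1)"
    if feas: "sdp_feasible n m A B V" for V
  proof -
    obtain T where T: "T \<in> carrier_mat (n + m) (n + m)" and VT: "V = T * mat_adjoint T"
      and col: "\<And>j. j < n + m \<Longrightarrow> \<exists>x w c. x \<in> carrier_vec n \<and> w \<in> carrier_vec m \<and> cmod c = 1 \<and>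
        col T j = x @\<^sub>v w \<and> A *\<^sub>v x + B *\<^sub>v w = c \<cdot>\<^sub>v x"
      and power: "(\<Sum>j<n + m. sqnorm (input_block *\<^sub>v col T j)) \<le> 1"
      and obj: "sdp_objective C D V = (\<Sum>j<n + m. sqnorm ((C @\<^sub>c D) *\<^sub>v col T j))"
      using feasible_decomposition[OF feas] by metis
    have "sqnorm (col T j) \<le> (K + 1) * sqnorm (input_block *\<^sub>v col T j)" if j: "j < n + m" for j
    proof -
      from col[OF j] obtain x w c where xw: "x \<in> carrier_vec n" "w \<in> carrier_vec m"
        and c: "cmod c = 1" "A *\<^sub>v x + B *\<^sub>v w = c \<cdot>\<^sub>v x" and eq: "col T j = x @\<^sub>v w" by blast
      show ?thesis
        unfolding eq sqnorm_append block_mult_vec(2)[OF xw] using gain[OF xw c] by (simp add: distrib_right)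
    qed
    then have "(\<Sum>j<n+m. sqnorm (col T j)) \<le> (\<Sum>j<n+m. (K + 1) * sqnorm (input_block *\<^sub>v col T j))"
      by (intro sum_mono) auto
    also have "\<dots> = (K + 1) * (\<Sum>j<n+m. sqnorm (input_block *\<^sub>v col T j))" by (simp only: sum_distrib_left)
    also have "\<dots> \<le> (K + 1) * 1" using K power by (intro mult_left_mono) auto
    finally have total: "(\<Sum>j<n+m. sqnorm (col T j)) \<le> K + 1" by simp
    have "sdp_objective C D V \<le> (\<Sum>j<n+m. M * sqnorm (col T j))"
      unfolding obj using M(2) T by (intro sum_mono) auto
    also have "\<dots> \<le> M * (K + 1)"
      unfolding sum_distrib_left[symmetric] using total M(1) by (rule mult_left_mono)
    finally have "sdp_objective C D V \<le> M * (K + 1)" .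
    moreover have "cmod (V $$ (a, b)) \<le> K + 1" if "a < n + m" "b < n + m" for a b
      using gram_entry_bound[OF T that] total unfolding VT by linarith
    ultimately show ?thesis by blast
  qed
  then show thesis by (intro that[of "K + 1" "M * (K + 1)"]) auto
qed

lemma sdp_maximum_attained: "\<exists>s. is_maximum (sdp_values n m A B C D) s"
proof -
  let ?S = "sdp_values n m A B C D"
  obtain K M where K: "\<And>V a b. sdp_feasible n m A B V \<Longrightarrow> a < n + m \<Longrightarrow> b < n + m \<Longrightarrow> cmod (V $$ (a, b)) \<le> K"
    and M: "\<And>V. sdp_feasible n m A B V \<Longrightarrow> sdp_objective C D V \<le> M"
    using sdp_bounded by metis
  have bdd: "bdd_above ?S" using M unfolding sdp_values_def bdd_above_def by blast
  let ?Z = "0\<^sub>m (n + m) (n + m) :: complex mat"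
  have Z: "?Z = ?Z * mat_adjoint ?Z" by simp
  have "sdp_feasible n m A B ?Z"
    unfolding sdp_feasible_iff
  proof (intro conjI)
    show "pos_semidef ?Z" by (subst Z) (rule pos_semidef_gram[of _ "n + m" "n + m"], simp)
    show "state_block * ?Z * mat_adjoint state_block = (A @\<^sub>c B) * ?Z * mat_adjoint (A @\<^sub>c B)"
      unfolding right_mult_zero_mat[OF carriers(1)] right_mult_zero_mat[OF carriers(3)]
        left_mult_zero_mat[OF mat_adjoint_carrier[OF carriers(1)]]
        left_mult_zero_mat[OF mat_adjoint_carrier[OF carriers(3)]] ..
    show "Re (mat_trace (input_block * ?Z * mat_adjoint input_block)) \<le> 1"
      unfolding right_mult_zero_mat[OF carriers(2)] left_mult_zero_mat[OF mat_adjoint_carrier[OF carriers(2)]]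
      by (simp add: mat_trace_def)
  qed simp
  then have ne: "?S \<noteq> {}" unfolding sdp_values_def by blast
  have "\<exists>V. sdp_feasible n m A B V \<and> Sup ?S - 1 / real (Suc k) < sdp_objective C D V" for k
  proof -
    have "Sup ?S - 1 / real (Suc k) < Sup ?S" by simp
    then obtain s where "s \<in> ?S" "Sup ?S - 1 / real (Suc k) < s" using less_cSup_iff[OF ne bdd] by blast
    then show ?thesis unfolding sdp_values_def by blast
  qed
  then obtain V where V: "\<And>k. sdp_feasible n m A B (V k)"
    and near: "\<And>k. Sup ?S - 1 / real (Suc k) < sdp_objective C D (V k)" by metis
  have upper: "sdp_objective C D (V k) \<le> Sup ?S" for k
    by (rule cSup_upper[OF _ bdd]) (use V in \<open>auto simp: sdp_values_def\<close>)
  have "(\<lambda>k. sdp_objective C D (V k)) \<longlonglongrightarrow> Sup ?S"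
  proof (rule tendsto_sandwich[where h = "\<lambda>_. Sup ?S"])
    have "(\<lambda>k. Sup ?S - 1 / real (Suc k)) \<longlonglongrightarrow> Sup ?S - 0"
      by (intro tendsto_diff tendsto_const LIMSEQ_Suc[OF lim_1_over_n])
    then show "(\<lambda>k. Sup ?S - 1 / real (Suc k)) \<longlonglongrightarrow> Sup ?S" by simp
  qed (use less_imp_le[OF near] upper in \<open>simp_all add: always_eventually\<close>)
  then have "Sup ?S \<in> ?S"
    by (rule sdp_values_closed[of V K "\<lambda>_. 1" 1, rotated -1]) (use V K in \<open>auto simp: sdp_feasible_iff\<close>)
  then show ?thesis unfolding is_maximum_def using cSup_upper[OF _ bdd] by blast
qed

text \<open>
Averaged second moments of the trajectory, evaluated at times where the state is not large, are
asymptotically feasible.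
\<close>
lemma lti_values_subset_sdp_values: "lti_values n m A B C D \<subseteq> sdp_values n m A B C D"
proof
  fix s assume "s \<in> lti_values n m A B C D"
  then obtain w x where s: "s = lim (avg_power (lti_output C D w x))" and feas: "lti_feasible n m A B C D w x"
    by (auto simp: lti_values_def)
  have w: "\<And>k. w k \<in> carrier_vec m" and x: "\<And>k. x k \<in> carrier_vec n" and x0: "x 0 = 0\<^sub>v n"
    and step: "\<And>k. x (Suc k) = A *\<^sub>v x k + B *\<^sub>v w k"
    and conv_w: "convergent (avg_power w)" and conv_z: "convergent (avg_power (lti_output C D w x))"
    and power: "power_norm w \<le> 1"
    using feas by (auto simp: lti_feasible_def)
  obtain K where K: "0 \<le> K" and gain: "\<And>N. (\<Sum>k<N. sqnorm (x k)) \<le> K * (\<Sum>k<N. sqnorm (w k))"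
    using state_gain[of thesis] x w x0 step by metis
  obtain P where P: "P > 0" "\<And>N. norm (avg_power w N) \<le> P"
    using BseqD[OF convergent_imp_Bseq[OF conv_w]] by auto
  have w_sum: "(\<Sum>k<N. sqnorm (w k)) \<le> P * real N" for N
  proof (cases "N = 0")
    case False
    then show ?thesis using P(2)[of N] by (simp add: avg_power_sqnorm field_simps)
  qed simp
  have x_sum: "(\<Sum>k<N. sqnorm (x k)) \<le> K * P * real N" for N
    using gain[of N] mult_left_mono[OF w_sum[of N] K] by (simp add: mult.assoc)
  \<comment> \<open>\<open>K * P\<close> bounds the average of \<open>|x k|\<^sup>2\<close>, so not all times between \<open>j\<close> and \<open>2 * j + 2\<close> can exceed twice that.\<close>
  have "\<exists>N>j. sqnorm (x N) \<le> 2 * (K * P)" for j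
  proof (rule ccontr)
    assume "\<not> ?thesis"
    then have big: "\<And>N. N > j \<Longrightarrow> 2 * (K * P) < sqnorm (x N)" by (meson not_le)
    have "(K * P) * real (2 * Suc j) = (\<Sum>k=Suc j..<2 * Suc j. 2 * (K * P))" by simp
    also have "\<dots> < (\<Sum>k=Suc j..<2 * Suc j. sqnorm (x k))"
      by (rule sum_strict_mono) (auto intro: big)
    also have "\<dots> \<le> (\<Sum>k<2 * Suc j. sqnorm (x k))"
      by (rule sum_mono2) (auto simp: sqnorm_nonneg)
    also have "\<dots> \<le> (K * P) * real (2 * Suc j)" by (rule x_sum)
    finally show False by simp
  qed
  then obtain T where T: "\<And>j. T j > j" and xT: "\<And>j. sqnorm (x (T j)) \<le> 2 * (K * P)" by metis
  have Tpos: "T j > 0" for j using T[of j] by linarith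
  have T_lim: "filterlim T at_top sequentially"
    by (rule filterlim_at_top_mono[OF filterlim_ident]) (use T in \<open>auto intro!: always_eventually less_imp_le\<close>)
  define v where "v k = x k @\<^sub>v w k" for k
  have v: "v k \<in> carrier_vec (n + m)" for k using x w by (simp add: v_def)
  \<comment> \<open>The factor \<open>1 / \<surd>T\<close> on each column puts the weight \<open>1 / T\<close> on each second moment, so that \<open>V j\<close> is an average.\<close>
  define \<gamma> where "\<gamma> j = complex_of_real (1 / sqrt (real (T j)))" for j
  define R where "R j = mat (n + m) (T j) (\<lambda>(i, k). \<gamma> j * v k $ i)" for j
  have R: "R j \<in> carrier_mat (n + m) (T j)" for j by (simp add: R_def)
  define V where "V j = R j * mat_adjoint (R j)" for j
  have Vc: "V j \<in> carrier_mat (n + m) (n + m)" for j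
    unfolding V_def by (rule mult_carrier_mat[OF R mat_adjoint_carrier[OF R]])
  have col: "col (R j) k = \<gamma> j \<cdot>\<^sub>v v k" if "k < T j" for j k
    using that v[of k] by (intro eq_vecI) (auto simp: R_def)
  have scale: "(cmod (\<gamma> j))\<^sup>2 = 1 / real (T j)" for j
    using Tpos[of j] by (simp add: \<gamma>_def norm_divide power_divide)
  have Mcol: "M *\<^sub>v col (R j) k = \<gamma> j \<cdot>\<^sub>v (M *\<^sub>v v k)"
    if "M \<in> carrier_mat r (n + m)" "k < T j" for M r j k
    unfolding col[OF that(2)] by (rule mult_mat_vec[OF that(1) v])
  have trace: "Re (mat_trace (M * V j * mat_adjoint M)) = (1 / real (T j)) * (\<Sum>k<T j. sqnorm (M *\<^sub>v v k))"
    if M: "M \<in> carrier_mat r (n + m)" for M r j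
    unfolding V_def trace_gram_sandwich[OF M R]
    using Mcol[OF M, of _ j] by (simp only: sum_distrib_left) (auto simp: sqnorm_smult scale intro!: sum.cong)
  have power_V: "Re (mat_trace (input_block * V j * mat_adjoint input_block)) = avg_power w (T j)" for j
    unfolding trace[OF carriers(2)] avg_power_sqnorm v_def by (simp add: block_mult_vec[OF x w])
  have obj_V: "sdp_objective C D (V j) = avg_power (lti_output C D w x) (T j)" for j
    unfolding sdp_objective_def trace[OF carriers(4)] avg_power_sqnorm v_def lti_output_def
    by (simp add: block_mult_vec[OF x w])
  have entry: "(M * V j * mat_adjoint M) $$ (a, b) =
      complex_of_real (1 / real (T j)) * (\<Sum>k<T j. (M *\<^sub>v v k) $ a * cnj ((M *\<^sub>v v k) $ b))"
    if M: "M \<in> carrier_mat r (n + m)" and ab: "a < r" "b < r" for M r j a b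
  proof -
    have c: "\<gamma> j * cnj (\<gamma> j) = complex_of_real (1 / real (T j))"
      unfolding complex_norm_square[symmetric] using scale by simp
    show ?thesis
      unfolding V_def sandwich_gram_index[OF M R ab] sum_distrib_left c[symmetric]
    proof (rule sum.cong[OF refl])
      fix k assume "k \<in> {..<T j}"
      then have k: "k < T j" by simp
      show "(M *\<^sub>v col (R j) k) $ a * cnj ((M *\<^sub>v col (R j) k) $ b) =
        \<gamma> j * cnj (\<gamma> j) *
        ((M *\<^sub>v v k) $ a * cnj ((M *\<^sub>v v k) $ b))"
        unfolding Mcol[OF M k] using M ab by (simp add: mult_ac)
    qed
  qed
  show "s \<in> sdp_values n m A B C D"
  proof (rule sdp_values_closed[of V "K * P + P" "\<lambda>j. avg_power w (T j)" "lim (avg_power w)"])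
    show "pos_semidef (V j)" for j unfolding V_def by (rule pos_semidef_gram[OF R])
    show "cmod (V j $$ (a, b)) \<le> K * P + P" if "a < n + m" "b < n + m" for j a b
    proof -
      have "cmod (V j $$ (a, b)) \<le> (\<Sum>k<T j. sqnorm (col (R j) k))"
        unfolding V_def by (rule gram_entry_bound[OF R that])
      also have "\<dots> = (1 / real (T j)) * ((\<Sum>k<T j. sqnorm (x k)) + (\<Sum>k<T j. sqnorm (w k)))"
        unfolding sum.distrib[symmetric] sum_distrib_left
        using col[of _ j] by (intro sum.cong) (auto simp: sqnorm_smult scale v_def sqnorm_append)
      also have "\<dots> \<le> (1 / real (T j)) * ((K * P + P) * real (T j))"
        using x_sum[of "T j"] w_sum[of "T j"] by (intro mult_left_mono) (auto simp: distrib_right)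
      finally show ?thesis using Tpos[of j] by simp
    qed
    show "(\<lambda>j. (state_block * V j * mat_adjoint state_block) $$ (a, b) - ((A @\<^sub>c B) * V j * mat_adjoint (A @\<^sub>c B)) $$ (a, b)) \<longlonglongrightarrow> 0"
      if ab: "a < n" "b < n" for a b
    proof (rule tendsto_zero_dominated)
      \<comment> \<open>Time shift: the two sums over \<open>x\<^sub>k x\<^sub>k\<^sup>*\<close> and \<open>x\<^sub>k\<^sub>+\<^sub>1 x\<^sub>k\<^sub>+\<^sub>1\<^sup>*\<close> differ only by their end terms.\<close>
      have eq: "(state_block * V j * mat_adjoint state_block) $$ (a, b) - ((A @\<^sub>c B) * V j * mat_adjoint (A @\<^sub>c B)) $$ (a, b)
          = complex_of_real (1 / real (T j)) * (- (x (T j) $ a * cnj (x (T j) $ b)))" for j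
      proof -
        have "(\<Sum>k<T j. x k $ a * cnj (x k $ b)) - (\<Sum>k<T j. x (Suc k) $ a * cnj (x (Suc k) $ b))
          = x 0 $ a * cnj (x 0 $ b) - x (T j) $ a * cnj (x (T j) $ b)"
          unfolding sum_subtractf[symmetric] by (rule sum_lessThan_telescope')
        then show ?thesis
          unfolding entry[OF carriers(1) ab] entry[OF carriers(3) ab] right_diff_distrib[symmetric] v_def
            block_mult_vec[OF x w] step[symmetric]
          using ab by (simp add: x0)
      qed
      have le: "cmod (x (T j) $ a * cnj (x (T j) $ b)) \<le> 2 * (K * P)" for j
      proof -
        have "cmod (x (T j) $ i) \<le> sqrt (2 * (K * P))" if "i < n" for i
          using cmod_sq_le_sqnorm[of i "x (T j)"] xT[of j] x[of "T j"] that by (simp add: real_le_rsqrt)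
        then have "cmod (x (T j) $ a) * cmod (x (T j) $ b) \<le> sqrt (2 * (K * P)) * sqrt (2 * (K * P))"
          using ab K P(1) by (intro mult_mono) auto
        then show ?thesis using K P(1) by (simp add: norm_mult)
      qed
      show "\<forall>\<^sub>F j in sequentially. norm ((state_block * V j * mat_adjoint state_block) $$ (a, b) - ((A @\<^sub>c B) * V j * mat_adjoint (A @\<^sub>c B)) $$ (a, b))
          \<le> (1 / real (T j)) * (2 * (K * P))"
      proof (intro always_eventually allI)
        fix j
        have "norm ((state_block * V j * mat_adjoint state_block) $$ (a, b) - ((A @\<^sub>c B) * V j * mat_adjoint (A @\<^sub>c B)) $$ (a, b))
            = (1 / real (T j)) * cmod (x (T j) $ a * cnj (x (T j) $ b))"
          unfolding eq by (simp add: norm_mult norm_divide)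
        also have "\<dots> \<le> (1 / real (T j)) * (2 * (K * P))" using le by (intro mult_left_mono) auto
        finally show "norm ((state_block * V j * mat_adjoint state_block) $$ (a, b) - ((A @\<^sub>c B) * V j * mat_adjoint (A @\<^sub>c B)) $$ (a, b))
            \<le> (1 / real (T j)) * (2 * (K * P))" .
      qed
      have "(\<lambda>j. (1 / real (T j)) * (2 * (K * P))) \<longlonglongrightarrow> 0 * (2 * (K * P))"
        by (intro tendsto_mult tendsto_const filterlim_compose[OF lim_1_over_n T_lim])
      then show "(\<lambda>j. (1 / real (T j)) * (2 * (K * P))) \<longlonglongrightarrow> 0" by simp
    qed
    show "(\<lambda>j. avg_power w (T j)) \<longlonglongrightarrow> lim (avg_power w)"
      using filterlim_compose[OF _ T_lim] conv_w by (simp add: convergent_LIMSEQ_iff)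
    show "lim (avg_power w) \<le> 1" using power by (simp add: power_norm_def)
    show "(\<lambda>j. sdp_objective C D (V j)) \<longlonglongrightarrow> s"
      unfolding obj_V s using filterlim_compose[OF _ T_lim] conv_z by (simp add: convergent_LIMSEQ_iff)
  qed (use Vc power_V in auto)
qed

lemma power_iterate_shift:
  "x \<in> carrier_vec n \<Longrightarrow> (A ^\<^sub>m Suc k) *\<^sub>v x = A *\<^sub>v ((A ^\<^sub>m k) *\<^sub>v x)"
proof (induction k arbitrary: x)
  case 0
  then show ?case using A by simp
next
  case (Suc k)
  have Ax: "A *\<^sub>v x \<in> carrier_vec n" using A Suc.prems by simp
  have "(A ^\<^sub>m Suc (Suc k)) *\<^sub>v x = (A ^\<^sub>m Suc k) *\<^sub>v (A *\<^sub>v x)"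
    using assoc_mult_mat_vec[OF pow_carrier_mat[OF A] A Suc.prems, of "Suc k"] by simp
  also have "\<dots> = A *\<^sub>v ((A ^\<^sub>m Suc k) *\<^sub>v x)"
    using Suc.IH[OF Ax] assoc_mult_mat_vec[OF pow_carrier_mat[OF A] A Suc.prems, of k] by simp
  finally show ?case .
qed

lemma power_iterate_tendsto_0:
  assumes x: "x \<in> carrier_vec n"
  shows "(\<lambda>k. sqnorm ((A ^\<^sub>m k) *\<^sub>v x)) \<longlonglongrightarrow> 0"
proof -
  obtain c r where c: "0 \<le> c" and r: "0 < r" "r < 1" and bound: "\<And>k. norm_bound (A ^\<^sub>m k) (c * r ^ k)"
    using schur_stable_power_bound[OF A n stable] by blast
  show ?thesis
  proof (rule tendsto_zero_dominated)
    show "\<forall>\<^sub>F k in sequentially. norm (sqnorm ((A ^\<^sub>m k) *\<^sub>v x)) \<le> real n * real n * (c * r ^ k)\<^sup>2 * sqnorm x"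
      using sqnorm_mult_mat_vec_le[OF pow_carrier_mat[OF A] x bound] c r
      by (intro always_eventually allI) (simp add: sqnorm_nonneg)
    have "(\<lambda>k. real n * real n * (c * r ^ k)\<^sup>2 * sqnorm x) \<longlonglongrightarrow> real n * real n * (c * 0)\<^sup>2 * sqnorm x"
      using r by (intro tendsto_intros LIMSEQ_power_zero) auto
    then show "(\<lambda>k. real n * real n * (c * r ^ k)\<^sup>2 * sqnorm x) \<longlonglongrightarrow> 0" by simp
  qed
qed

text \<open>
The input \<open>c\<^sup>k w\<close> sustains the state \<open>c\<^sup>k x\<close>; the zero initial state adds the transient \<open>- A\<^sup>k x\<close>. It
decays, so the power of the output is that of the harmonic \<open>c\<^sup>k (C x + D w)\<close>.
\<close>
lemma resonant_input_lti_value: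
  assumes x: "x \<in> carrier_vec n" and w: "w \<in> carrier_vec m" and c: "cmod c = 1"
    and eig: "A *\<^sub>v x + B *\<^sub>v w = c \<cdot>\<^sub>v x" and w1: "sqnorm w \<le> 1"
  shows "sqnorm (C *\<^sub>v x + D *\<^sub>v w) \<in> lti_values n m A B C D"
proof -
  define W where "W k = c ^ k \<cdot>\<^sub>v w" for k
  \<comment> \<open>The stationary response minus the free response that cancels it at time 0.\<close>
  define X where "X k = c ^ k \<cdot>\<^sub>v x - (A ^\<^sub>m k) *\<^sub>v x" for k
  define g where "g = C *\<^sub>v x + D *\<^sub>v w"
  have g: "g \<in> carrier_vec l" using C D x w by (simp add: g_def)
  have W: "W k \<in> carrier_vec m" for k using w by (simp add: W_def)
  have Akx: "(A ^\<^sub>m k) *\<^sub>v x \<in> carrier_vec n" for k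
    by (rule mult_mat_vec_carrier[OF pow_carrier_mat[OF A] x])
  have X: "X k \<in> carrier_vec n" for k using x Akx by (simp add: X_def)
  have cx: "c ^ k \<cdot>\<^sub>v x \<in> carrier_vec n" for k using x by simp
  have ck: "cmod (c ^ k) = 1" for k using c by (simp add: norm_power)
  \<comment> \<open>Every output of the system is the stationary harmonic minus a transient.\<close>
  have affine: "M *\<^sub>v X k + N *\<^sub>v W k = c ^ k \<cdot>\<^sub>v (M *\<^sub>v x + N *\<^sub>v w) - M *\<^sub>v ((A ^\<^sub>m k) *\<^sub>v x)"
    if M: "M \<in> carrier_mat p n" and N: "N \<in> carrier_mat p m" for M N p k
  proof -
    have "M *\<^sub>v X k = c ^ k \<cdot>\<^sub>v (M *\<^sub>v x) - M *\<^sub>v ((A ^\<^sub>m k) *\<^sub>v x)"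
      unfolding X_def mult_minus_distrib_mat_vec[OF M cx Akx] mult_mat_vec[OF M x] ..
    moreover have "N *\<^sub>v W k = c ^ k \<cdot>\<^sub>v (N *\<^sub>v w)" unfolding W_def by (rule mult_mat_vec[OF N w])
    ultimately show ?thesis using M N by (intro eq_vecI) (auto simp: algebra_simps)
  qed
  have X0: "X 0 = 0\<^sub>v n" using x A by (auto simp: X_def)
  have X_step: "X (Suc k) = A *\<^sub>v X k + B *\<^sub>v W k" for k
    unfolding affine[OF A B] eig power_iterate_shift[OF x, symmetric] unfolding X_def
    by (simp add: smult_smult_assoc mult.commute)
  have W_power: "avg_power W \<longlonglongrightarrow> sqnorm w"
    unfolding avg_power_sqnorm[abs_def] by (rule cesaro_mean) (simp add: W_def sqnorm_smult ck)
  obtain KC where KC: "KC \<ge> 0" "\<And>v. v \<in> carrier_vec n \<Longrightarrow> sqnorm (C *\<^sub>v v) \<le> KC * sqnorm v"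
    using bounded_mat_vec[OF C] by blast
  have transient: "(\<lambda>k. sqnorm (C *\<^sub>v ((A ^\<^sub>m k) *\<^sub>v x))) \<longlonglongrightarrow> 0"
  proof (rule tendsto_zero_dominated)
    show "\<forall>\<^sub>F k in sequentially. norm (sqnorm (C *\<^sub>v ((A ^\<^sub>m k) *\<^sub>v x))) \<le> KC * sqnorm ((A ^\<^sub>m k) *\<^sub>v x)"
      using KC(2)[OF Akx] by (intro always_eventually allI) (simp add: sqnorm_nonneg)
    show "(\<lambda>k. KC * sqnorm ((A ^\<^sub>m k) *\<^sub>v x)) \<longlonglongrightarrow> 0"
      using tendsto_mult_left[OF power_iterate_tendsto_0[OF x], of KC] by simp
  qed
  let ?z = "lti_output C D W X"
  have z: "?z k = c ^ k \<cdot>\<^sub>v g - C *\<^sub>v ((A ^\<^sub>m k) *\<^sub>v x)" for k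
    unfolding lti_output_def g_def by (rule affine[OF C D])
  have "(\<lambda>k. cmod (?z k $ i)) \<longlonglongrightarrow> cmod (g $ i)" if i: "i < l" for i
  proof (rule LIM_zero_cancel, rule tendsto_zero_dominated)
    let ?t = "\<lambda>k. C *\<^sub>v ((A ^\<^sub>m k) *\<^sub>v x)"
    show "\<forall>\<^sub>F k in sequentially. norm (cmod (?z k $ i) - cmod (g $ i)) \<le> sqrt (sqnorm (?t k))"
    proof (intro always_eventually allI)
      fix k
      have "cmod (c ^ k * g $ i) = cmod (g $ i)" using ck by (simp add: norm_mult)
      moreover have zi: "?z k $ i = c ^ k * g $ i - ?t k $ i" unfolding z using i g C by simp
      ultimately have "\<bar>cmod (?z k $ i) - cmod (g $ i)\<bar> \<le> cmod (?t k $ i)"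
        using norm_triangle_ineq3[of "?z k $ i" "c ^ k * g $ i"] by simp
      moreover have "cmod (?t k $ i) \<le> sqrt (sqnorm (?t k))"
        using cmod_sq_le_sqnorm[of i "?t k"] i C by (simp add: real_le_rsqrt)
      ultimately show "norm (cmod (?z k $ i) - cmod (g $ i)) \<le> sqrt (sqnorm (?t k))" by simp
    qed
    show "(\<lambda>k. sqrt (sqnorm (?t k))) \<longlonglongrightarrow> 0" using tendsto_real_sqrt[OF transient] by simp
  qed
  then have "(\<lambda>k. \<Sum>i<l. (cmod (?z k $ i))\<^sup>2) \<longlonglongrightarrow> (\<Sum>i<l. (cmod (g $ i))\<^sup>2)"
    by (intro tendsto_sum tendsto_power) auto
  moreover have "dim_vec (?z k) = l" for k unfolding lti_output_def using C D by simp
  ultimately have "(\<lambda>k. sqnorm (?z k)) \<longlonglongrightarrow> sqnorm g" using g by (simp add: sqnorm_def)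
  then have z_power: "avg_power ?z \<longlonglongrightarrow> sqnorm g"
    unfolding avg_power_sqnorm[abs_def] by (rule cesaro_mean)
  have "lti_feasible n m A B C D W X"
    unfolding lti_feasible_def power_norm_def limI[OF W_power]
    using W X X0 X_step W_power z_power w1 convergentI by (auto simp: sqnorm_nonneg)
  moreover have "sqnorm g = lim (avg_power ?z)" using limI[OF z_power] by simp
  ultimately show ?thesis unfolding lti_values_def g_def by blast
qed

text \<open>
In a maximal point some rank-one term must have an output-to-input power ratio of at least the
maximum, since otherwise the weighted sum over the terms would stay below it. Scaled to unit input
power, this term gives a trajectory whose value cannot exceed the maximum either.
\<close>
lemma sdp_maximum_in_lti_values:
  assumes max: "is_maximum (sdp_values n m A B C D) s"
  shows "s \<in> lti_values n m A B C D"
proof -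
  have upper: "t \<le> s" if "t \<in> lti_values n m A B C D" for t
    using that max lti_values_subset_sdp_values by (auto simp: is_maximum_def)
  show ?thesis
  proof (cases "s > 0")
    case False
    have "sqnorm (C *\<^sub>v 0\<^sub>v n + D *\<^sub>v 0\<^sub>v m) \<in> lti_values n m A B C D"
      by (rule resonant_input_lti_value[of _ _ 1]) (use A B in auto)
    moreover have "C *\<^sub>v 0\<^sub>v n + D *\<^sub>v 0\<^sub>v m = 0\<^sub>v l" using C D by auto
    ultimately have "0 \<in> lti_values n m A B C D" by simp
    moreover from upper[OF this] have "s = 0" using False by simp
    ultimately show ?thesis by simp
  next
    case True
    obtain V where V: "sdp_feasible n m A B V" and s: "s = sdp_objective C D V"
      using max by (auto simp: is_maximum_def sdp_values_def)
    obtain T where T: "T \<in> carrier_mat (n + m) (n + m)"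
      and col: "\<And>j. j < n + m \<Longrightarrow> \<exists>x w c. x \<in> carrier_vec n \<and> w \<in> carrier_vec m \<and> cmod c = 1 \<and>
        col T j = x @\<^sub>v w \<and> A *\<^sub>v x + B *\<^sub>v w = c \<cdot>\<^sub>v x"
      and power: "(\<Sum>j<n + m. sqnorm (input_block *\<^sub>v col T j)) \<le> 1"
      and obj: "s = (\<Sum>j<n + m. sqnorm ((C @\<^sub>c D) *\<^sub>v col T j))"
      using feasible_decomposition[OF V] unfolding s by metis
    define p where "p j = sqnorm (input_block *\<^sub>v col T j)" for j
    define z where "z j = sqnorm ((C @\<^sub>c D) *\<^sub>v col T j)" for j
    obtain K where gain: "\<And>x w c. x \<in> carrier_vec n \<Longrightarrow> w \<in> carrier_vec m \<Longrightarrow> cmod c = 1 \<Longrightarrow>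
      A *\<^sub>v x + B *\<^sub>v w = c \<cdot>\<^sub>v x \<Longrightarrow> sqnorm x \<le> K * sqnorm w"
      using state_gain by metis
    \<comment> \<open>A term without input power has no state either, hence no output.\<close>
    have z0: "z j = 0" if j: "j < n + m" and pj: "p j = 0" for j
    proof -
      from col[OF j] obtain x w c where xw: "x \<in> carrier_vec n" "w \<in> carrier_vec m"
        and c: "cmod c = 1" "A *\<^sub>v x + B *\<^sub>v w = c \<cdot>\<^sub>v x" and eq: "col T j = x @\<^sub>v w" by blast
      have "sqnorm w = 0" using pj unfolding p_def eq block_mult_vec(2)[OF xw] .
      moreover from this have "sqnorm x = 0" using gain[OF xw c] sqnorm_nonneg[of x] by simp
      ultimately have "x = 0\<^sub>v n" "w = 0\<^sub>v m" using sqnorm_eq_0D xw by auto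
      then have "(C @\<^sub>c D) *\<^sub>v col T j = 0\<^sub>v l"
        unfolding eq block_mult_vec(4)[OF xw] using C D by auto
      then show ?thesis by (simp add: z_def)
    qed
    have "\<exists>j<n + m. p j > 0 \<and> s * p j \<le> z j"
    proof (rule ccontr)
      assume "\<not> ?thesis"
      then have less: "z j < s * p j" if "j < n + m" "p j > 0" for j using that by (meson not_le)
      have p_nonneg: "p j \<ge> 0" for j by (simp add: p_def sqnorm_nonneg)
      have le: "z j \<le> s * p j" if "j < n + m" for j
        using z0[OF that] less[OF that] p_nonneg[of j] by (cases "p j = 0") auto
      have "\<exists>j\<in>{..<n + m}. z j < s * p j"
      proof (rule ccontr)
        assume "\<not> ?thesis"
        then have "p j = 0" if "j < n + m" for j using less[OF that] that p_nonneg[of j] by force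
        then have "s = 0" using z0 unfolding obj z_def[symmetric] by simp
        then show False using True by simp
      qed
      then have "(\<Sum>j<n + m. z j) < (\<Sum>j<n + m. s * p j)"
        using le by (intro sum_strict_mono_ex1) auto
      also have "\<dots> \<le> s * 1"
        unfolding sum_distrib_left[symmetric] p_def using power True by (intro mult_left_mono) auto
      finally show False using obj by (simp add: z_def)
    qed
    then obtain j where j: "j < n + m" and pj: "p j > 0" and best: "s * p j \<le> z j" by blast
    from col[OF j] obtain x w c where xw: "x \<in> carrier_vec n" "w \<in> carrier_vec m"
      and c: "cmod c = 1" and eig: "A *\<^sub>v x + B *\<^sub>v w = c \<cdot>\<^sub>v x" and eq: "col T j = x @\<^sub>v w" by blast
    have pw: "p j = sqnorm w" unfolding p_def eq block_mult_vec(2)[OF xw] ..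
    have zw: "z j = sqnorm (C *\<^sub>v x + D *\<^sub>v w)" unfolding z_def eq block_mult_vec(4)[OF xw] ..
    let ?a = "complex_of_real (1 / sqrt (p j))"
    have a: "(cmod ?a)\<^sup>2 = 1 / p j" using pj by (simp add: norm_divide power_divide)
    have scaled: "M *\<^sub>v (?a \<cdot>\<^sub>v x) + N *\<^sub>v (?a \<cdot>\<^sub>v w) = ?a \<cdot>\<^sub>v (M *\<^sub>v x + N *\<^sub>v w)"
      if M: "M \<in> carrier_mat r n" and N: "N \<in> carrier_mat r m" for M N r
      unfolding mult_mat_vec[OF M xw(1)] mult_mat_vec[OF N xw(2)]
      by (rule smult_add_distrib_vec[OF mult_mat_vec_carrier[OF M xw(1)] mult_mat_vec_carrier[OF N xw(2)], symmetric])
    have "sqnorm (C *\<^sub>v (?a \<cdot>\<^sub>v x) + D *\<^sub>v (?a \<cdot>\<^sub>v w)) \<in> lti_values n m A B C D"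
    proof (rule resonant_input_lti_value)
      show "A *\<^sub>v (?a \<cdot>\<^sub>v x) + B *\<^sub>v (?a \<cdot>\<^sub>v w) = c \<cdot>\<^sub>v (?a \<cdot>\<^sub>v x)"
        unfolding scaled[OF A B] eig by (simp add: smult_smult_assoc mult.commute)
      show "sqnorm (?a \<cdot>\<^sub>v w) \<le> 1" unfolding sqnorm_smult a using pj pw by simp
    qed (use xw c in auto)
    moreover have "sqnorm (C *\<^sub>v (?a \<cdot>\<^sub>v x) + D *\<^sub>v (?a \<cdot>\<^sub>v w)) = z j / p j"
      unfolding scaled[OF C D] sqnorm_smult a zw by simp
    ultimately have attained: "z j / p j \<in> lti_values n m A B C D" by simp
    moreover have "s \<le> z j / p j" using best pj by (simp add: field_simps)
    ultimately show ?thesis using upper[OF attained] by simp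
  qed
qed

end

lemma is_maximum_Sup: "is_maximum S s \<Longrightarrow> Sup S = s"
  unfolding is_maximum_def by (intro cSup_eq_maximum) auto

theorem theorem1:
  fixes n m l :: nat and A B C D :: "complex mat"
  assumes "n \<ge> 1" and "m \<ge> 1" and "l \<ge> 1"
    and "A \<in> carrier_mat n n" and "B \<in> carrier_mat n m"
    and "C \<in> carrier_mat l n" and "D \<in> carrier_mat l m"
    and "schur_stable A"
  shows "is_maximum (sdp_values n m A B C D) (mu_opt n m A B C D) \<and>
         is_maximum (lti_values n m A B C D) (hinf_sq n m A B C D) \<and>
         mu_opt n m A B C D = hinf_sq n m A B C D"
proof -
  interpret stable_system n m l A B C D
    using assms by unfold_locales (auto simp: schur_stable_def)
  obtain s where sdp: "is_maximum (sdp_values n m A B C D) s" using sdp_maximum_attained by blast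
  have lti: "is_maximum (lti_values n m A B C D) s"
    using sdp sdp_maximum_in_lti_values[OF sdp] lti_values_subset_sdp_values by (auto simp: is_maximum_def)
  show ?thesis
    using sdp lti unfolding mu_opt_def hinf_sq_def is_maximum_Sup[OF sdp] is_maximum_Sup[OF lti] by blast
qed

end
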